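(* Let $C(n)$ denote the maximum number of touching pairs among all packings of $n$ congruent spheres in $\mathbb{R}^3$. Then $$C(8)=18.$$
   Context: A packing of $n$ congruent spheres in $\mathbb{R}^3$ is a family of $n$ spheres $x_i+\mathbb{S}^2$ ($1\le i\le n$, $x_i\in\mathbb{R}^3$, where $\mathbb{S}^2$ is the unit sphere centered at the origin) bounding closed unit balls with pairwise disjoint interiors; equivalently, $\|x_i-x_j\|\ge 2$ for all $i\ne j$. A touching pair is an unordered pair $\{i,j\}$ with $i\neq j$ such that the two spheres are tangent, i.e. $\|x_i-x_j\|=2$. The contact number $C(n)$ is the maximum, over all such packings of $n$ spheres, of the number of touching pairs. *)

theory Defs
  imports "HOL-Analysis.Analysis"
begin

definition unit_sphere_packing :: "nat \<Rightarrow> (nat \<Rightarrow> real ^ 3) \<Rightarrow> bool" where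
  "unit_sphere_packing n x \<longleftrightarrow>
     disjoint_family_on (\<lambda>i. interior (cball (x i) 1)) {1..n}"

definition touching_pairs :: "nat \<Rightarrow> (nat \<Rightarrow> real ^ 3) \<Rightarrow> nat set set" where
  "touching_pairs n x =
     {{i, j} | i j. i \<in> {1..n} \<and> j \<in> {1..n} \<and> i \<noteq> j \<and> norm (x i - x j) = 2}"

text \<open>The set below is finite and nonempty for every \<open>n\<close> (\<open>contact_counts_finite\<close>,
  \<open>contact_counts_nonempty\<close>), so \<open>Max\<close> is a genuine maximum.\<close>

definition contact_number :: "nat \<Rightarrow> nat" where
  "contact_number n = Max {card (touching_pairs n x) | x. unit_sphere_packing n x}"

lemma unit_sphere_packing_iff:
  "unit_sphere_packing n x \<longleftrightarrow>
     (\<forall>i\<in>{1..n}. \<forall>j\<in>{1..n}. i \<noteq> j \<longrightarrow> norm (x i - x j) \<ge> 2)"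
proof -
  have "ball a 1 \<inter> ball b 1 = {} \<longleftrightarrow> norm (a - b) \<ge> 2" for a b :: "real ^ 3"
  proof
    assume disj: "ball a 1 \<inter> ball b 1 = {}"
    show "norm (a - b) \<ge> 2"
    proof (rule ccontr)
      assume "\<not> norm (a - b) \<ge> 2"
      then have "midpoint a b \<in> ball a 1 \<inter> ball b 1"
        by (simp only: Int_iff mem_ball dist_midpoint) (simp add: dist_norm)
      with disj show False
        by blast
    qed
  next
    assume "norm (a - b) \<ge> 2"
    then show "ball a 1 \<inter> ball b 1 = {}"
      by (intro disjoint_ballI) (simp add: dist_norm)
  qed
  then show ?thesis
    by (simp add: unit_sphere_packing_def disjoint_family_on_def)
qed

lemma contact_counts_finite:
  "finite {card (touching_pairs n x) | x. unit_sphere_packing n x}"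
proof (rule finite_subset)
  show "{card (touching_pairs n x) | x. unit_sphere_packing n x} \<subseteq> card ` Pow (Pow {1..n})"
    by (auto simp: touching_pairs_def intro!: imageI)
qed simp

lemma contact_counts_nonempty:
  "{card (touching_pairs n x) | x. unit_sphere_packing n x} \<noteq> {}"
proof -
  have "unit_sphere_packing n (\<lambda>i. (2 * real i) *\<^sub>R axis 1 1)"
    unfolding unit_sphere_packing_iff
  proof (intro ballI impI)
    fix i j :: nat
    assume "i \<noteq> j"
    then have "\<bar>2 * real i - 2 * real j\<bar> \<ge> 2"
      by linarith
    moreover have "norm ((2 * real i) *\<^sub>R axis 1 1 - (2 * real j) *\<^sub>R axis 1 1 :: real ^ 3)
        = \<bar>2 * real i - 2 * real j\<bar>"
      by (simp flip: scaleR_diff_left)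
    ultimately show
      "norm ((2 * real i) *\<^sub>R axis 1 1 - (2 * real j) *\<^sub>R axis 1 1 :: real ^ 3) \<ge> 2"
      by simp
  qed
  then show ?thesis
    by blast
qed

end

theory Submission
  imports Defs
begin

text \<open>Eighteen contacts are attained by a regular octahedron with a sphere resting on each of two
opposite faces. For the upper bound, the eight centers are studied through their \<^emph>\<open>gaps\<close>: the pairs
of distinct centers that do not touch. Eight points have 28 pairs, so nineteen contacts leave nine
gaps, and a graph with so few edges can be pinned down by hand.

Two geometric facts cut down the possible gap graphs. Three points of space never all touch three
other points (\<open>no_three_touch_three\<close>), because the common neighbors of three points lie on a line
and on a sphere. In terms of gaps, a set of three points must have at least \<open>n - 5\<close> outside
neighbors in the gap graph on \<open>n\<close> points (\<open>three_points_bound\<close>). Secondly, the common neighbors of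
two touching points lie on a circle, where consecutive contacts subtend the angle with cosine
\<open>1 / 3\<close>; this angle is not a rational multiple of a full turn, so contacts around a contact never
close up to a cycle (\<open>no_cycle_around_contact\<close>). In particular there are no five pairwise touching
points.

These two facts bound the number of contacts of six points by 12 and of seven points by 15
(\<open>gap_sum_six\<close>, \<open>gap_sum_seven\<close>). Hence in a packing of eight points with nineteen contacts every
point has at most three gaps, since deleting a point with four gaps would leave seven points with
sixteen contacts.

The remaining gap graphs on eight points with nine edges and maximal degree three are sorted by
their isolated points and their leaves. An isolated point touches everything. Two of them give a
cycle around a contact. A single one, together with the three points of degree two, forms a regular
tetrahedron. Either one of the other four points completes it to five pairwise touching points, or
repeated reflections of its vertices determine the positions of all others but at most one, and the
contacts that are left over cannot be realized (\<open>no_contact_closes_star\<close>,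
\<open>no_contact_closes_strip\<close>). Without isolated points there are at most three leaves: three leaves
give five pairwise touching points, and for zero, one or two leaves the packing contains an
octahedron with two further points capping two of its faces, and the two caps never touch
(\<open>octahedron_caps_apart\<close>).\<close>

section \<open>Points touching a common set of points\<close>

lemma parallel_if_orthogonal_to_plane:
  fixes x y m n :: "real ^ 3"
  assumes x: "m \<bullet> x = 0" "n \<bullet> x = 0" and y: "m \<bullet> y = 0" "n \<bullet> y = 0" "y \<noteq> 0"
    and mn: "cross3 m n \<noteq> 0"
  shows "\<exists>t. x = t *\<^sub>R y"
proof -
  have par: "\<exists>c. z = c *\<^sub>R cross3 m n" if "m \<bullet> z = 0" "n \<bullet> z = 0" for z
  proof -
    have "cross3 (cross3 m n) z = 0"
      using that cross_skew[of "cross3 m n" z] by (simp add: Lagrange inner_commute)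
    then show ?thesis
      using mn by (auto simp: cross_eq_0 collinear_lemma)
  qed
  obtain c d where c: "x = c *\<^sub>R cross3 m n" and d: "y = d *\<^sub>R cross3 m n"
    using par x y by meson
  then have "x = (c / d) *\<^sub>R y"
    using y(3) by auto
  then show ?thesis
    by blast
qed

text \<open>Contacts are handled as equations between inner products, where the orthogonality relations that
they imply follow by linear arithmetic.\<close>

lemma dist_eq_two_iff: "dist p q = 2 \<longleftrightarrow> (p - q) \<bullet> (p - q) = 4"
  for p q :: "'a :: real_inner"
proof -
  have "dist p q = 2 \<longleftrightarrow> (dist p q)\<^sup>2 = 2\<^sup>2"
    by (metis power2_eq_iff_nonneg zero_le_dist zero_le_numeral)
  then show ?thesis
    by (simp add: dist_norm power2_norm_eq_inner)
qed

lemma two_le_dist_iff: "2 \<le> dist p q \<longleftrightarrow> 4 \<le> (p - q) \<bullet> (p - q)"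
  for p q :: "'a :: real_inner"
proof -
  have "2 \<le> dist p q \<longleftrightarrow> 2\<^sup>2 \<le> (dist p q)\<^sup>2"
    by (metis abs_le_square_iff abs_numeral abs_of_nonneg zero_le_dist)
  then show ?thesis
    by (simp add: dist_norm power2_norm_eq_inner)
qed

lemmas inner_expand = inner_diff_left inner_diff_right inner_add_left inner_add_right inner_commute

lemma not_collinear_on_sphere:
  fixes p q r x :: "real ^ 3"
  assumes "dist x p = 2" "dist x q = 2" "dist x r = 2" and ne: "p \<noteq> q" "p \<noteq> r" "q \<noteq> r"
  shows "cross3 (q - p) (r - p) \<noteq> 0"
proof
  assume "cross3 (q - p) (r - p) = 0"
  then obtain t where t: "r - p = t *\<^sub>R (q - p)"
    using ne by (auto simp: cross_eq_0 collinear_lemma)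
  define d where "d = q - p"
  have r: "r = p + t *\<^sub>R d" and q: "q = p + d"
    using t by (auto simp: d_def algebra_simps)
  have "d \<bullet> d \<noteq> 0"
    using ne by (simp add: d_def)
  have 1: "d \<bullet> d = 2 * ((x - p) \<bullet> d)"
    using assms(1,2) unfolding dist_eq_two_iff q by (simp add: inner_expand)
  have 2: "t * t * (d \<bullet> d) = t * (2 * ((x - p) \<bullet> d))"
    using assms(1,3) unfolding dist_eq_two_iff r by (simp add: inner_expand algebra_simps)
  have "t * (t - 1) * (d \<bullet> d) = 0"
    using 2 unfolding 1[symmetric] by (simp add: algebra_simps)
  then have "t = 0 \<or> t = 1"
    using \<open>d \<bullet> d \<noteq> 0\<close> by simp
  then show False
    using ne r q by auto
qed

text \<open>If \<open>p\<close>, \<open>q\<close>, \<open>r\<close> all touch \<open>x\<close>, \<open>y\<close>, \<open>z\<close>, then the differences within the first triple are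
orthogonal to those within the second. The first triple is not collinear, so the second one lies on
a line. But a sphere meets a line in at most two points.\<close>

lemma no_three_touch_three:
  fixes p q r x y z :: "real ^ 3"
  assumes "distinct [p, q, r]" "distinct [x, y, z]"
    and "\<And>a b. a \<in> {x, y, z} \<Longrightarrow> b \<in> {p, q, r} \<Longrightarrow> dist a b = 2"
  shows False
proof -
  have orth: "(b - p) \<bullet> (a - x) = 0" if "a \<in> {x, y, z}" "b \<in> {p, q, r}" for a b
  proof -
    have "dist a b = 2" "dist a p = 2" "dist x b = 2" "dist x p = 2"
      using assms(3) that by blast+
    then show ?thesis
      unfolding dist_eq_two_iff by (simp add: inner_expand)
  qed
  have "cross3 (q - p) (r - p) \<noteq> 0"
    using assms by (intro not_collinear_on_sphere[of x]) auto
  then obtain t where "z - x = t *\<^sub>R (y - x)"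
    using parallel_if_orthogonal_to_plane[of "q - p" "z - x" "r - p" "y - x"] orth assms(2) by auto
  then have "cross3 (y - x) (z - x) = 0"
    by (simp add: cross_mult_right)
  moreover have "cross3 (y - x) (z - x) \<noteq> 0"
    using assms(2) by (intro not_collinear_on_sphere[of p]) (auto simp: assms(3) dist_commute[of p])
  ultimately show False
    by simp
qed


section \<open>Reflections in triangles of touching points\<close>

text \<open>Besides \<open>a\<close>, only the mirror image of \<open>a\<close> in the plane of three touching points touches all
three. The linear formula for it lets distances propagate through chains of tetrahedra. In the
proof, the defect \<open>v\<close> of the formula is orthogonal to the triangle \<open>u w b\<close> and to \<open>a - c\<close>, while
\<open>a - c\<close> spans the normal direction of the triangle.\<close>

lemma reflection_in_triangle:
  fixes a b c u w :: "real ^ 3"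
  assumes tri: "dist u w = 2" "dist u b = 2" "dist w b = 2"
    and a: "dist a u = 2" "dist a w = 2" "dist a b = 2"
    and c: "dist c u = 2" "dist c w = 2" "dist c b = 2" and "a \<noteq> c"
  shows "c = (2 / 3) *\<^sub>R (u + w + b) - a"
proof -
  define v where "v = 3 *\<^sub>R (a + c) - 2 *\<^sub>R (u + w + b)"
  have v: "(w - u) \<bullet> v = 0" "(b - u) \<bullet> v = 0" "(a - c) \<bullet> v = 0"
    and d: "(w - u) \<bullet> (a - c) = 0" "(b - u) \<bullet> (a - c) = 0"
    using tri a c unfolding dist_eq_two_iff v_def by (simp_all add: inner_expand)
  have "w \<noteq> b" "u \<noteq> w" "u \<noteq> b"
    using tri by auto
  then have "cross3 (w - u) (b - u) \<noteq> 0"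
    using a by (intro not_collinear_on_sphere[of a]) auto
  then obtain t where "v = t *\<^sub>R (a - c)"
    using parallel_if_orthogonal_to_plane[OF v(1,2) d] \<open>a \<noteq> c\<close> by auto
  then have "v = 0"
    using v(3) by force
  then have "3 *\<^sub>R (a + c) = 2 *\<^sub>R (u + w + b)"
    by (simp add: v_def)
  then have "(1/3) *\<^sub>R (3 *\<^sub>R (a + c)) = (1/3) *\<^sub>R (2 *\<^sub>R (u + w + b))"
    by (rule arg_cong)
  then show ?thesis
    by (simp add: eq_diff_eq add.commute)
qed

text \<open>The integer \<open>scaled_cos n\<close> is \<open>3 ^ n * cos (n * \<theta>)\<close> for the angle \<open>\<theta>\<close> with cosine \<open>1 / 3\<close>, by
the recurrence of the Chebyshev polynomials. Modulo 3 the last term of the recurrence vanishes, so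
no value is divisible by 3, and \<open>n * \<theta>\<close> is never a full turn for \<open>n > 0\<close>.\<close>

fun scaled_cos :: "nat \<Rightarrow> int" where
  "scaled_cos 0 = 1"
| "scaled_cos (Suc 0) = 1"
| "scaled_cos (Suc (Suc n)) = 2 * scaled_cos (Suc n) - 9 * scaled_cos n"

lemma not_three_dvd_scaled_cos: "\<not> 3 dvd scaled_cos n"
proof (induction n rule: scaled_cos.induct)
  case (3 n)
  show ?case
  proof
    assume "3 dvd scaled_cos (Suc (Suc n))"
    then have "3 dvd 2 * scaled_cos (Suc n) - 9 * scaled_cos n + 9 * scaled_cos n"
      unfolding scaled_cos.simps by (rule dvd_add) simp
    then have "3 dvd 2 * scaled_cos (Suc n)"
      by simp
    then show False
      using 3 by presburger
  qed
qed auto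

text \<open>If every point of \<open>S\<close> had two contacts in \<open>S\<close>, one could walk around the circle of common
neighbors of \<open>u\<close> and \<open>w\<close> forever without turning back. Each step is the reflection of
\<open>reflection_in_triangle\<close>, that is, a rotation by the same angle. Since no positive multiple of that
angle is a full turn, the walk visits infinitely many points.\<close>

lemma no_cycle_around_contact:
  fixes u w :: "real ^ 3"
  assumes uw: "dist u w = 2" and S: "finite S" "S \<noteq> {}"
    and touch: "\<And>s. s \<in> S \<Longrightarrow> dist s u = 2 \<and> dist s w = 2"
    and two: "\<And>s. s \<in> S \<Longrightarrow> \<exists>a\<in>S. \<exists>c\<in>S. a \<noteq> c \<and> dist a s = 2 \<and> dist c s = 2"
  shows False
proof -
  define step where "step = (\<lambda>(a, b). (b, (2 / 3) *\<^sub>R (u + w + b) - a))"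
  obtain s0 s1 where s01: "s0 \<in> S" "s1 \<in> S" "dist s0 s1 = 2"
    using S two by (metis all_not_in_conv dist_commute)
  define s where "s n = fst ((step ^^ n) (s0, s1))" for n
  have pair: "(step ^^ n) (s0, s1) = (s n, s (Suc n))" for n
    by (simp add: s_def step_def split_beta)
  have s_rec: "s (Suc (Suc n)) = (2 / 3) *\<^sub>R (u + w + s (Suc n)) - s n" for n
    using arg_cong[OF pair[of n], of "\<lambda>x. snd (step x)"] pair[of "Suc n"]
    by (simp add: step_def)
  have inS: "s n \<in> S \<and> s (Suc n) \<in> S \<and> dist (s n) (s (Suc n)) = 2" for n
  proof (induction n)
    case 0
    then show ?case
      using s01 by (simp add: s_def step_def)
  next
    case (Suc n)
    obtain c where c: "c \<in> S" "c \<noteq> s n" "dist c (s (Suc n)) = 2"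
      using two Suc by metis
    have "c = (2 / 3) *\<^sub>R (u + w + s (Suc n)) - s n"
      by (rule reflection_in_triangle)
        (use uw Suc c touch in \<open>simp_all add: dist_commute[of u "s _"] dist_commute[of w "s _"]\<close>)
    then have "c = s (Suc (Suc n))"
      by (simp add: s_rec)
    then show ?case
      using Suc c by (simp add: dist_commute)
  qed
  \<comment> \<open>The position relative to the center of the circle; all these vectors have squared norm 3.\<close>
  define y where "y n = s n - (1 / 2) *\<^sub>R (u + w)" for n
  have y_rec: "y (Suc (Suc n)) = (2 / 3) *\<^sub>R y (Suc n) - y n" for n
    by (simp add: y_def s_rec vec_eq_iff field_simps)
  have y0: "y n \<bullet> y n = 3" and y1: "y n \<bullet> y (Suc n) = 1" for n
  proof -
    have "dist (s n) u = 2" "dist (s n) w = 2" "dist (s (Suc n)) u = 2" "dist (s (Suc n)) w = 2"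
      "dist (s n) (s (Suc n)) = 2"
      using inS[of n] touch by auto
    with uw show "y n \<bullet> y n = 3" "y n \<bullet> y (Suc n) = 1"
      unfolding dist_eq_two_iff y_def by (simp_all add: inner_expand field_simps)
  qed
  have cos: "3 ^ k * (y n \<bullet> y (n + k)) = 3 * of_int (scaled_cos k)" for n k
  proof (induction k rule: scaled_cos.induct)
    case (3 k)
    then show ?case
      by (simp add: y_rec inner_diff_right algebra_simps)
  qed (auto simp: y0 y1)
  have "s n \<noteq> s (n + Suc k)" for n k
  proof
    assume "s n = s (n + Suc k)"
    then have "y n \<bullet> y (n + Suc k) = 3"
      using y0[of n] by (simp add: y_def)
    then have "of_int (3 ^ Suc k) = (of_int (scaled_cos (Suc k)) :: real)"
      using cos[of "Suc k" n] by simp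
    then have "scaled_cos (Suc k) = 3 ^ Suc k"
      unfolding of_int_eq_iff by simp
    then show False
      using not_three_dvd_scaled_cos[of "Suc k"] by simp
  qed
  then have "inj s"
    by (intro linorder_injI) (metis less_imp_Suc_add add_Suc_right)
  moreover have "range s \<subseteq> S"
    using inS by auto
  ultimately show False
    using S(1) by (meson finite_imageD finite_subset infinite_UNIV_nat)
qed


text \<open>Take three faces of a regular tetrahedron that meet in \<open>u\<close>, and reflect the opposite vertex in each
of them. A point \<open>w\<close> touching \<open>u\<close> and the three images would satisfy \<open>(w - u) \<bullet> (a - u) = 6\<close>,
although both vectors have norm 2.\<close>

lemma no_contact_closes_star:
  fixes u a b c x y z w :: "real ^ 3"
  assumes tetra: "dist u a = 2" "dist u b = 2" "dist u c = 2" "dist a b = 2" "dist a c = 2" "dist b c = 2"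
    and x: "x \<noteq> a" "dist x u = 2" "dist x b = 2" "dist x c = 2"
    and y: "y \<noteq> b" "dist y u = 2" "dist y a = 2" "dist y c = 2"
    and z: "z \<noteq> c" "dist z u = 2" "dist z a = 2" "dist z b = 2"
    and w: "dist w u = 2" "dist w x = 2" "dist w y = 2" "dist w z = 2"
  shows False
proof -
  have refl: "x = (2 / 3) *\<^sub>R (u + b + c) - a" "y = (2 / 3) *\<^sub>R (u + a + c) - b"
    "z = (2 / 3) *\<^sub>R (u + a + b) - c"
    using assms by (auto intro!: reflection_in_triangle simp: dist_commute)
  define A B C W where "A = a - u" and "B = b - u" and "C = c - u" and "W = w - u"
  have X: "x - u = (2 / 3) *\<^sub>R (B + C) - A" "y - u = (2 / 3) *\<^sub>R (A + C) - B"
    "z - u = (2 / 3) *\<^sub>R (A + B) - C"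
    unfolding refl by (simp_all add: A_def B_def C_def vec_eq_iff field_simps)
  have W: "W \<bullet> W = 4" "A \<bullet> A = 4"
    using w(1) tetra(1) unfolding dist_eq_two_iff W_def A_def by (simp_all add: inner_expand)
  have "W \<bullet> v = 2" if "dist w p = 2" "dist p u = 2" "p - u = v" for p v
    using that w(1) unfolding dist_eq_two_iff W_def that(3)[symmetric] by (simp add: inner_expand)
  then have "W \<bullet> ((2 / 3) *\<^sub>R (B + C) - A) = 2" "W \<bullet> ((2 / 3) *\<^sub>R (A + C) - B) = 2"
    "W \<bullet> ((2 / 3) *\<^sub>R (A + B) - C) = 2"
    using w x y z X by blast+
  then have "W \<bullet> A = 6"
    by (simp add: inner_add_right inner_diff_right field_simps)
  then have "(W - A) \<bullet> (W - A) < 0"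
    using W by (simp add: inner_diff_left inner_diff_right inner_commute)
  then show False
    using inner_ge_zero[of "W - A"] by linarith
qed

text \<open>Five tetrahedra with the common vertex \<open>u\<close>, glued along a strip of triangles \<open>r s a\<close>, \<open>s a b\<close>,
\<open>a b c\<close>, \<open>b c p\<close>, \<open>c p q\<close>. Reflections express the two ends of the strip through \<open>a\<close>, \<open>b\<close>,
\<open>c\<close>, and their distance is \<open>32 / 9\<close>.\<close>

lemma no_contact_closes_strip:
  fixes u a b c p q r s :: "real ^ 3"
  assumes tetra: "dist u a = 2" "dist u b = 2" "dist u c = 2" "dist a b = 2" "dist a c = 2" "dist b c = 2"
    and s: "s \<noteq> c" "dist s u = 2" "dist s a = 2" "dist s b = 2"
    and p: "p \<noteq> a" "dist p u = 2" "dist p b = 2" "dist p c = 2"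
    and r: "r \<noteq> b" "dist r u = 2" "dist r a = 2" "dist r s = 2"
    and q: "q \<noteq> b" "dist q u = 2" "dist q c = 2" "dist q p = 2"
  shows "dist q r \<noteq> 2"
proof
  assume qr: "dist q r = 2"
  have s_eq: "s = (2 / 3) *\<^sub>R (u + a + b) - c" and p_eq: "p = (2 / 3) *\<^sub>R (u + b + c) - a"
    using assms by (auto intro!: reflection_in_triangle simp: dist_commute)
  have r_eq: "r = (2 / 3) *\<^sub>R (u + a + s) - b" and q_eq: "q = (2 / 3) *\<^sub>R (u + c + p) - b"
    using assms by (auto intro!: reflection_in_triangle simp: dist_commute)
  have "q - r = (16 / 9) *\<^sub>R (c - a)"
    unfolding q_eq r_eq p_eq s_eq by (simp add: vec_eq_iff field_simps)
  then have "(q - r) \<bullet> (q - r) = (256 / 81) * ((c - a) \<bullet> (c - a))"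
    by simp
  then show False
    using qr tetra(5) unfolding dist_commute[of a c] dist_eq_two_iff by simp
qed


section \<open>Octahedra and caps on their faces\<close>

lemma eq_zero_if_orthogonal_to_frame:
  fixes n k l v :: "real ^ 3"
  assumes "n \<noteq> 0" "k \<noteq> 0" "l \<noteq> 0" "n \<bullet> k = 0" "n \<bullet> l = 0" "k \<bullet> l = 0"
    and v: "n \<bullet> v = 0" "k \<bullet> v = 0" "l \<bullet> v = 0"
  shows "v = 0"
proof -
  have "cross3 n k \<noteq> 0"
    using assms by (metis norm_and_cross_eq_0)
  then obtain t where "v = t *\<^sub>R l"
    using parallel_if_orthogonal_to_plane[of n v k l] assms by auto
  with v(3) show ?thesis
    by auto
qed

text \<open>Each of the three diagonals is orthogonal to the other two, because the ends of one diagonal are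
equidistant from both ends of another. The difference of two midpoints is orthogonal to all three
diagonals, so the midpoints agree, and then the twelve contacts determine the half diagonals.\<close>

lemma octahedron_frame:
  fixes a b c a' b' c' :: "real ^ 3"
  assumes ne: "a \<noteq> a'" "b \<noteq> b'" "c \<noteq> c'"
    and touch: "dist a b = 2" "dist a c = 2" "dist a b' = 2" "dist a c' = 2"
      "dist a' b = 2" "dist a' c = 2" "dist a' b' = 2" "dist a' c' = 2"
      "dist b c = 2" "dist c b' = 2" "dist b' c' = 2" "dist c' b = 2"
  obtains m e f g where "a = m + e" "a' = m - e" "b = m + f" "b' = m - f" "c = m + g" "c' = m - g"
    "e \<bullet> e = 2" "f \<bullet> f = 2" "g \<bullet> g = 2" "e \<bullet> f = 0" "e \<bullet> g = 0" "f \<bullet> g = 0"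
proof -
  note T = touch[unfolded dist_eq_two_iff, simplified inner_expand]
  have orth: "(a - a') \<bullet> (b - b') = 0" "(a - a') \<bullet> (c - c') = 0" "(b - b') \<bullet> (c - c') = 0"
    using T by (simp_all add: inner_expand)
  have ne': "a - a' \<noteq> 0" "b - b' \<noteq> 0" "c - c' \<noteq> 0"
    using ne by simp_all
  have "(a + a') - (b + b') = 0" "(a + a') - (c + c') = 0"
    by (intro eq_zero_if_orthogonal_to_frame[OF ne' orth]; use T in \<open>simp add: inner_expand\<close>)+
  then have mid: "b + b' = a + a'" "c + c' = a + a'"
    by simp_all
  define m where "m = (1 / 2) *\<^sub>R (a + a')"
  have half: "z = m + (1 / 2) *\<^sub>R (z - z')" "z' = m - (1 / 2) *\<^sub>R (z - z')"
    if "z + z' = a + a'" for z z' :: "real ^ 3"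
    unfolding m_def that[symmetric] by (simp_all add: vec_eq_iff field_simps)
  define e where "e = (1 / 2) *\<^sub>R (a - a')"
  define f where "f = (1 / 2) *\<^sub>R (b - b')"
  define g where "g = (1 / 2) *\<^sub>R (c - c')"
  have pos: "a = m + e" "a' = m - e" "b = m + f" "b' = m - f" "c = m + g" "c' = m - g"
    using half[OF refl] half[OF mid(1)] half[OF mid(2)] unfolding e_def f_def g_def by blast+
  have orth': "e \<bullet> f = 0" "e \<bullet> g = 0" "f \<bullet> g = 0"
    using orth by (simp_all add: e_def f_def g_def)
  have "e \<bullet> e + f \<bullet> f = 4" "e \<bullet> e + g \<bullet> g = 4" "f \<bullet> f + g \<bullet> g = 4"
    using touch(1,2,9) orth' unfolding dist_eq_two_iff pos by (simp_all add: inner_expand)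
  then have "e \<bullet> e = 2" "f \<bullet> f = 2" "g \<bullet> g = 2"
    by simp_all
  then show ?thesis
    using that pos orth' by blast
qed

text \<open>A point touching the three corners of a face is \<open>m + (t / 2) *\<^sub>R (e + f + g)\<close> with \<open>t = 2\<close> or
\<open>t = - 2 / 3\<close>. The second solution is the center of the opposite face, too close to
the corner \<open>m - e\<close>.\<close>

lemma cap_of_octahedron_face:
  fixes x m e f g :: "real ^ 3"
  assumes norms: "e \<bullet> e = 2" "f \<bullet> f = 2" "g \<bullet> g = 2" and orth: "e \<bullet> f = 0" "e \<bullet> g = 0" "f \<bullet> g = 0"
    and touch: "dist x (m + e) = 2" "dist x (m + f) = 2" "dist x (m + g) = 2"
    and far: "2 \<le> dist x (m - e)"
  shows "x = m + e + f + g"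
proof -
  define y t where "y = x - m" and "t = y \<bullet> e"
  have y: "y \<bullet> y - 2 * (y \<bullet> e) = 2" "y \<bullet> y - 2 * (y \<bullet> f) = 2" "y \<bullet> y - 2 * (y \<bullet> g) = 2"
    and far': "2 \<le> y \<bullet> y + 2 * (y \<bullet> e)"
    using touch far norms unfolding dist_eq_two_iff two_le_dist_iff y_def
    by (simp_all add: inner_expand)
  have t: "y \<bullet> f = t" "y \<bullet> g = t"
    using y by (simp_all add: t_def)
  have "y - (t / 2) *\<^sub>R (e + f + g) = 0"
    using norms orth t by (intro eq_zero_if_orthogonal_to_frame[of e f g])
      (auto simp: inner_expand t_def)
  then have y_eq: "y = (t / 2) *\<^sub>R (e + f + g)"
    by simp
  have "y \<bullet> y = 3 * t\<^sup>2 / 2"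
    unfolding y_eq using norms orth by (simp add: inner_expand power2_eq_square field_simps)
  then have "3 * t\<^sup>2 - 4 * t - 4 = 0"
    using y(1) by (simp add: t_def field_simps)
  then have "(t - 2) * (3 * t + 2) = 0"
    by (simp add: power2_eq_square algebra_simps)
  moreover have "3 * t + 2 \<noteq> 0"
    using y(1) far' by (auto simp: t_def)
  ultimately have "t = 2"
    by simp
  then have "x = m + (e + f + g)"
    using y_eq by (simp add: y_def algebra_simps)
  then show ?thesis
    by (simp add: algebra_simps)
qed

text \<open>The pairs of opposite corners are \<open>(a, a')\<close>, \<open>(b, b')\<close> and \<open>(c, c')\<close>; the corners of a pair
are only required to differ, and their distance is a consequence.\<close>

definition octahedron :: "real ^ 3 \<Rightarrow> real ^ 3 \<Rightarrow> real ^ 3 \<Rightarrow> real ^ 3 \<Rightarrow> real ^ 3 \<Rightarrow> real ^ 3 \<Rightarrow> bool" where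
  "octahedron a a' b b' c c' \<longleftrightarrow> a \<noteq> a' \<and> b \<noteq> b' \<and> c \<noteq> c' \<and>
    dist a b = 2 \<and> dist a c = 2 \<and> dist a b' = 2 \<and> dist a c' = 2 \<and>
    dist a' b = 2 \<and> dist a' c = 2 \<and> dist a' b' = 2 \<and> dist a' c' = 2 \<and>
    dist b c = 2 \<and> dist c b' = 2 \<and> dist b' c' = 2 \<and> dist c' b = 2"

text \<open>The three conclusions are the cases of opposite faces, of faces sharing one corner, and of faces
sharing an edge. The distances of the caps are \<open>2 * sqrt 6\<close>, \<open>4\<close> and \<open>2 * sqrt 2\<close>.\<close>

lemma octahedron_caps_apart:
  assumes oct: "octahedron a a' b b' c c'"
    and q: "dist q a = 2" "dist q b = 2" "dist q c = 2" "2 \<le> dist q a'"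
  shows "dist p a' = 2 \<Longrightarrow> dist p b' = 2 \<Longrightarrow> dist p c' = 2 \<Longrightarrow> 2 \<le> dist p a \<Longrightarrow> dist p q \<noteq> 2"
    and "dist p a = 2 \<Longrightarrow> dist p b' = 2 \<Longrightarrow> dist p c' = 2 \<Longrightarrow> 2 \<le> dist p a' \<Longrightarrow> dist p q \<noteq> 2"
    and "dist p a = 2 \<Longrightarrow> dist p b = 2 \<Longrightarrow> dist p c' = 2 \<Longrightarrow> 2 \<le> dist p a' \<Longrightarrow> dist p q \<noteq> 2"
proof -
  obtain m e f g where pos: "a = m + e" "a' = m - e" "b = m + f" "b' = m - f" "c = m + g" "c' = m - g"
    and norms: "e \<bullet> e = 2" "f \<bullet> f = 2" "g \<bullet> g = 2" and orth: "e \<bullet> f = 0" "e \<bullet> g = 0" "f \<bullet> g = 0"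
    using oct unfolding octahedron_def by (elim conjE) (rule octahedron_frame)
  have orth': "f \<bullet> e = 0" "g \<bullet> e = 0" "g \<bullet> f = 0"
    using orth by (simp_all add: inner_commute)
  have q_eq: "q = m + e + f + g"
    using cap_of_octahedron_face[of e f g q m] norms orth q pos by simp
  show "dist p q \<noteq> 2" if "dist p a' = 2" "dist p b' = 2" "dist p c' = 2" "2 \<le> dist p a"
  proof -
    have "p = m - e - f - g"
      using cap_of_octahedron_face[of "- e" "- f" "- g" p m] norms orth that pos by simp
    then have "p - q = - (2 *\<^sub>R (e + f + g))"
      by (simp add: q_eq scaleR_2)
    then show ?thesis
      using norms orth orth' unfolding dist_eq_two_iff by (simp add: inner_add_left inner_add_right)
  qed
  show "dist p q \<noteq> 2" if "dist p a = 2" "dist p b' = 2" "dist p c' = 2" "2 \<le> dist p a'"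
  proof -
    have "p = m + e - f - g"
      using cap_of_octahedron_face[of e "- f" "- g" p m] norms orth that pos by simp
    then have "p - q = - (2 *\<^sub>R (f + g))"
      by (simp add: q_eq scaleR_2)
    then show ?thesis
      using norms orth orth' unfolding dist_eq_two_iff by (simp add: inner_add_left inner_add_right)
  qed
  show "dist p q \<noteq> 2" if "dist p a = 2" "dist p b = 2" "dist p c' = 2" "2 \<le> dist p a'"
  proof -
    have "p = m + e + f - g"
      using cap_of_octahedron_face[of e f "- g" p m] norms orth that pos by simp
    then have "p - q = - (2 *\<^sub>R g)"
      by (simp add: q_eq scaleR_2)
    then show ?thesis
      using norms unfolding dist_eq_two_iff by simp
  qed
qed

section \<open>Sets with at most three elements\<close>

lemma card_two_with:
  assumes "card A = 2" "x \<in> A"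
  obtains y where "A = {x, y}" "x \<noteq> y"
  using assms by (auto simp: card_2_iff)

lemma card_three_with:
  assumes "card A = 3" "x \<in> A"
  obtains y z where "A = {x, y, z}" "distinct [x, y, z]"
proof -
  have "card (A - {x}) = 2"
    using assms by (simp add: card_ge_0_finite)
  then obtain y z where yz: "A - {x} = {y, z}" "y \<noteq> z"
    by (auto simp: card_2_iff)
  then have "A = {x, y, z}"
    using assms by auto
  moreover have "x \<noteq> y" "x \<noteq> z"
    using yz by auto
  ultimately show ?thesis
    using that yz by auto
qed

lemma card_three_with_two:
  assumes "card A = 3" "x \<in> A" "y \<in> A" "x \<noteq> y"
  obtains z where "A = {x, y, z}" "z \<noteq> x" "z \<noteq> y"
  using assms by (elim card_three_with[of A x]) auto

lemma subset_two_if_card_le: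
  assumes "finite A" "card A \<le> 2"
  obtains b c where "A \<subseteq> {b, c}"
proof -
  have "card A = 0 \<or> card A = 1 \<or> card A = 2"
    using assms by linarith
  then show ?thesis
    using assms that by (auto simp: card_1_singleton_iff card_2_iff)
qed

lemma subset_one_if_card_le:
  assumes "finite A" "card A \<le> 1"
  obtains b where "A \<subseteq> {b}"
proof -
  have "card A = 0 \<or> card A = 1"
    using assms by linarith
  then show ?thesis
    using assms that by (auto simp: card_1_singleton_iff)
qed

lemma card_two_eq: "A = {x, y}" if "card A = 2" "x \<in> A" "y \<in> A" "x \<noteq> y"
  using that by (auto simp: card_2_iff)

section \<open>The gap graph of a packing\<close>

definition gaps :: "(real ^ 3) set \<Rightarrow> real ^ 3 \<Rightarrow> (real ^ 3) set" where
  "gaps P p = {q \<in> P. q \<noteq> p \<and> dist p q \<noteq> 2}"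

locale packing =
  fixes P :: "(real ^ 3) set"
  assumes finite_P: "finite P"
    and separated: "p \<in> P \<Longrightarrow> q \<in> P \<Longrightarrow> p \<noteq> q \<Longrightarrow> 2 \<le> dist p q"
begin

abbreviation "N \<equiv> gaps P"

lemma gaps_subset: "N p \<subseteq> P" and not_self: "p \<notin> N p" and finite_gaps [simp]: "finite (N p)"
  using finite_P by (auto simp: gaps_def)

lemma gaps_sym: "q \<in> N p \<longleftrightarrow> p \<in> N q" if "p \<in> P" "q \<in> P"
  using that by (auto simp: gaps_def dist_commute)

lemma touch: "dist p q = 2" if "p \<in> P" "q \<in> P" "p \<noteq> q" "q \<notin> N p"
  using that by (auto simp: gaps_def)

text \<open>The form of \<open>no_three_touch_three\<close> used for counting: all points outside \<open>{x, y, z} \<union> B\<close> touch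
\<open>x\<close>, \<open>y\<close> and \<open>z\<close>, so there are at most two of them.\<close>

lemma three_points_bound:
  assumes "distinct [x, y, z]" "x \<in> P" "y \<in> P" "z \<in> P"
    and "N x \<union> N y \<union> N z \<subseteq> {x, y, z} \<union> B" and "finite B"
  shows "card P \<le> card B + 5"
proof (rule ccontr)
  assume "\<not> card P \<le> card B + 5"
  moreover have "card P - card ({x, y, z} \<union> B) \<le> card (P - ({x, y, z} \<union> B))"
    using \<open>finite B\<close> by (intro diff_card_le_card_Diff) simp
  moreover have "card ({x, y, z} \<union> B) \<le> 3 + card B"
    using card_Un_le[of "{x, y, z}" B] assms(1) by simp
  ultimately have "3 \<le> card (P - ({x, y, z} \<union> B))"
    by linarith
  then obtain T where "T \<subseteq> P - ({x, y, z} \<union> B)" "card T = 3"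
    by (meson obtain_subset_with_card_n)
  then obtain p q r where pqr: "{p, q, r} \<subseteq> P - ({x, y, z} \<union> B)" "distinct [p, q, r]"
    by (auto simp: card_3_iff)
  have "dist a b = 2" if "a \<in> {x, y, z}" "b \<in> {p, q, r}" for a b
    using that assms pqr by (intro touch) auto
  then show False
    using no_three_touch_three pqr assms(1) by blast
qed

text \<open>Two points without gaps touch each other and everything else. If no other point has more than
\<open>card P - 5\<close> gaps, then each of the others still has two contacts among the others, which
\<open>no_cycle_around_contact\<close> forbids.\<close>

lemma no_universal_pair:
  assumes uw: "u \<in> P" "w \<in> P" "u \<noteq> w" "N u = {}" "N w = {}"
    and few: "\<And>z. z \<in> P \<Longrightarrow> card (N z) + 5 \<le> card P"
  shows False
proof (rule no_cycle_around_contact[of u w "P - {u, w}"])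
  show "dist u w = 2"
    using uw by (intro touch) auto
  have two: "2 \<le> card (P - {u, w, z} - N z)" if "z \<in> P - {u, w}" for z
  proof -
    have "N z \<subseteq> P - {u, w, z}"
      using gaps_subset[of z] uw gaps_sym[of z u] gaps_sym[of z w] not_self[of z] that by auto
    then have "card (P - {u, w, z} - N z) = card (P - {u, w, z}) - card (N z)"
      by (simp add: card_Diff_subset)
    also have "card (P - {u, w, z}) = card P - 3"
      using that uw finite_P by (subst card_Diff_subset) auto
    finally show ?thesis
      using few[of z] that by auto
  qed
  show "P - {u, w} \<noteq> {}"
  proof
    assume "P - {u, w} = {}"
    then have "card P \<le> card {u, w}"
      by (intro card_mono) auto
    then show False
      using few[OF uw(1)] uw(3) by simp
  qed
  show "\<exists>a\<in>P - {u, w}. \<exists>c\<in>P - {u, w}. a \<noteq> c \<and> dist a z = 2 \<and> dist c z = 2"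
    if z: "z \<in> P - {u, w}" for z
  proof -
    obtain T where "T \<subseteq> P - {u, w, z} - N z" "card T = 2"
      using two[OF z] by (meson obtain_subset_with_card_n)
    then obtain a c where ac: "{a, c} \<subseteq> P - {u, w, z} - N z" "a \<noteq> c"
      by (auto simp: card_2_iff)
    then have "dist z a = 2" "dist z c = 2"
      using z by (auto intro!: touch)
    then show ?thesis
      using ac by (auto simp: dist_commute)
  qed
qed (use finite_P uw in \<open>auto intro!: touch simp: gaps_sym\<close>)

lemma no_K5:
  assumes "distinct [p, q, r, s, t]" "{p, q, r, s, t} \<subseteq> P"
    and "q \<notin> N p" "r \<notin> N p" "s \<notin> N p" "t \<notin> N p" "r \<notin> N q" "s \<notin> N q" "t \<notin> N q"
      "s \<notin> N r" "t \<notin> N r" "t \<notin> N s"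
  shows False
proof (rule no_cycle_around_contact[of p q "{r, s, t}"])
  have d: "dist p q = 2" "dist p r = 2" "dist p s = 2" "dist p t = 2" "dist q r = 2" "dist q s = 2"
    "dist q t = 2" "dist r s = 2" "dist r t = 2" "dist s t = 2"
    using assms by (auto intro!: touch)
  show "dist p q = 2"
    by fact
  show "dist z p = 2 \<and> dist z q = 2" if "z \<in> {r, s, t}" for z
    using d that by (auto simp: dist_commute)
  show "\<exists>a\<in>{r, s, t}. \<exists>c\<in>{r, s, t}. a \<noteq> c \<and> dist a z = 2 \<and> dist c z = 2"
    if "z \<in> {r, s, t}" for z
    using d that assms(1) by (auto simp: dist_commute)
qed auto

lemma packing_remove: "packing (P - {v})"
  using finite_P separated by unfold_locales auto

lemma sum_gaps_remove:
  assumes "v \<in> P"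
  shows "(\<Sum>p\<in>P. card (N p)) = (\<Sum>p\<in>P - {v}. card (gaps (P - {v}) p)) + 2 * card (N v)"
proof -
  have "card (N p) = card (gaps (P - {v}) p) + (if v \<in> N p then 1 else 0)" for p
  proof -
    have "gaps (P - {v}) p = N p - {v}"
      by (auto simp: gaps_def)
    then show ?thesis
      using card_Suc_Diff1[of "N p" v] by (auto simp del: card_Diff_insert)
  qed
  then have "(\<Sum>p\<in>P - {v}. card (N p)) = (\<Sum>p\<in>P - {v}. card (gaps (P - {v}) p))
      + card {p \<in> P - {v}. v \<in> N p}"
    using finite_P by (simp add: sum.distrib flip: sum.inter_filter)
  moreover have "{p \<in> P - {v}. v \<in> N p} = N v"
    using assms by (auto simp: gaps_def dist_commute)
  ultimately show ?thesis
    using assms finite_P by (simp add: sum.remove)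
qed

definition D :: "nat \<Rightarrow> (real ^ 3) set" where
  "D k = {p \<in> P. card (N p) = k}"

lemma in_D: "p \<in> D k \<longleftrightarrow> p \<in> P \<and> card (N p) = k"
  by (simp add: D_def)

lemma finite_D [simp]: "finite (D k)"
  using finite_P by (simp add: D_def)

lemma degree_counts:
  assumes "\<And>p. p \<in> P \<Longrightarrow> card (N p) \<le> 3"
  shows "card (D 0) + card (D 1) + card (D 2) + card (D 3) = card P" (is ?A)
    and "card (D 1) + 2 * card (D 2) + 3 * card (D 3) = (\<Sum>p\<in>P. card (N p))" (is ?B)
proof -
  define i where "i k p = (if card (N p) = k then 1 else 0 :: nat)" for k p
  have D: "card (D k) = (\<Sum>p\<in>P. i k p)" for k
    using finite_P by (simp add: D_def i_def flip: sum.inter_filter)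
  have "i 0 p + i 1 p + i 2 p + i 3 p = 1" "i 1 p + 2 * i 2 p + 3 * i 3 p = card (N p)" if "p \<in> P" for p
  proof -
    have "n = 0 \<or> n = 1 \<or> n = 2 \<or> n = 3" if "n = card (N p)" for n
      using assms[OF \<open>p \<in> P\<close>] that by linarith
    then show "i 0 p + i 1 p + i 2 p + i 3 p = 1" "i 1 p + 2 * i 2 p + 3 * i 3 p = card (N p)"
      unfolding i_def by fastforce+
  qed
  then have "(\<Sum>p\<in>P. i 0 p + i 1 p + i 2 p + i 3 p) = (\<Sum>p\<in>P. 1)"
    "(\<Sum>p\<in>P. i 1 p + 2 * i 2 p + 3 * i 3 p) = (\<Sum>p\<in>P. card (N p))"
    by (auto intro!: sum.cong)
  then show ?A ?B
    by (simp_all add: D sum.distrib sum_distrib_left)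
qed


text \<open>At most two gaps among six points would leave two triples without a gap between them. The sum counts
every gap twice.\<close>

lemma gap_sum_six:
  assumes P6: "card P = 6"
  shows "4 < (\<Sum>p\<in>P. card (N p))"
proof (rule ccontr)
  assume "\<not> 4 < (\<Sum>p\<in>P. card (N p))"
  then have sum: "(\<Sum>p\<in>P. card (N p)) \<le> 4"
    by simp
  have le: "(\<Sum>p\<in>A. card (N p)) \<le> 4" if "A \<subseteq> P" for A
    using sum_mono2[OF finite_P that, of "\<lambda>p. card (N p)"] sum by simp
  have bound: False if "distinct [x, y, z]" "{x, y, z} \<subseteq> P" "N x \<union> N y \<union> N z \<subseteq> {x, y, z}" for x y z
    using three_points_bound[of x y z "{}"] that P6 by auto
  have in_P: "y \<in> P \<and> x \<in> N y \<and> x \<noteq> y \<and> 1 \<le> card (N y)" if "x \<in> P" "y \<in> N x" for x y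
    using that gaps_subset[of x] gaps_sym[of x y] not_self[of x]
    by (auto simp: Suc_le_eq card_gt_0_iff)
  have deg2: "card (N x) \<le> 1" if x: "x \<in> P" for x
  proof (rule ccontr)
    assume "\<not> card (N x) \<le> 1"
    then obtain T where T: "T \<subseteq> N x" "card T = 2"
      by (metis not_less_eq_eq numeral_2_eq_2 One_nat_def obtain_subset_with_card_n)
    then obtain y z where yz: "y \<in> N x" "z \<in> N x" "y \<noteq> z"
      by (auto simp: card_2_iff)
    note y = in_P[OF x yz(1)] and z = in_P[OF x yz(2)]
    have "card (N x) + card (N y) + card (N z) \<le> 4"
      using le[of "{x, y, z}"] x y z yz by auto
    then have "card (N y) = 1" "card (N z) = 1" "card (N x) = 2"
      using y z \<open>\<not> card (N x) \<le> 1\<close> by linarith+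
    then have "N y = {x}" "N z = {x}" "N x = {y, z}"
      using y z yz by (auto simp: card_1_singleton_iff card_2_iff)
    then show False
      using bound[of x y z] x y z yz by auto
  qed
  have "\<exists>u\<in>P. N u = {}"
  proof (rule ccontr)
    assume "\<not> (\<exists>u\<in>P. N u = {})"
    then have "1 \<le> card (N p)" if "p \<in> P" for p
      using that by (auto simp: Suc_le_eq card_gt_0_iff)
    then have "card P \<le> (\<Sum>p\<in>P. card (N p))"
      using sum_mono[of P "\<lambda>p. 1" "\<lambda>p. card (N p)"] by simp
    with sum P6 show False
      by simp
  qed
  then obtain u where u: "u \<in> P" "N u = {}"
    by auto
  show False
  proof (cases "\<exists>x\<in>P. N x \<noteq> {}")
    case True
    then obtain x y where x: "x \<in> P" "y \<in> N x"
      by auto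
    note y = in_P[OF x]
    have "N x = {y}" "N y = {x}"
      using deg2[of x] deg2[of y] x y card_le_Suc0_iff_eq[of "N x"] card_le_Suc0_iff_eq[of "N y"]
      by auto
    then show False
      using bound[of x y u] x y u by auto
  next
    case False
    obtain T where "T \<subseteq> P" "card T = 3"
      using P6 obtain_subset_with_card_n[of 3 P] by auto
    then obtain x y z where "{x, y, z} \<subseteq> P" "distinct [x, y, z]"
      by (auto simp: card_3_iff)
    then show False
      using bound[of x y z] False by auto
  qed
qed

text \<open>Seven points with at most five gaps. Deleting a point with three gaps would contradict
\<open>gap_sum_six\<close>, so all degrees are at most two. By \<open>three_points_bound\<close>, every three points have two
outside neighbors, which is impossible for three points around a leaf. Counting shows that there is
a leaf with a further point of degree at most one beside it.\<close>

lemma gap_sum_seven: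
  assumes P7: "card P = 7"
  shows "10 < (\<Sum>p\<in>P. card (N p))"
proof (rule ccontr)
  assume "\<not> 10 < (\<Sum>p\<in>P. card (N p))"
  then have sum: "(\<Sum>p\<in>P. card (N p)) \<le> 10"
    by simp
  have le2: "card (N v) \<le> 2" if "v \<in> P" for v
  proof -
    interpret Q: packing "P - {v}"
      by (rule packing_remove)
    have "4 < (\<Sum>p\<in>P - {v}. card (gaps (P - {v}) p))"
      using that P7 finite_P by (intro Q.gap_sum_six) simp
    then show ?thesis
      using sum sum_gaps_remove[OF that] by linarith
  qed
  have le3: "card (N v) \<le> 3" if "v \<in> P" for v
    using le2[OF that] by simp
  have D3: "D 3 = {}"
    using le2 by (fastforce simp: in_D)
  have counts: "card (D 0) + card (D 1) + card (D 2) = 7" "card (D 1) + 2 * card (D 2) \<le> 10"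
    using degree_counts[OF le3] sum P7 D3 by simp_all
  have bound: False
    if "distinct [x, y, z]" "{x, y, z} \<subseteq> P" "N x \<union> N y \<union> N z \<subseteq> {x, y, z} \<union> {b}" for x y z b
    using three_points_bound[of x y z "{b}"] that P7 by auto
  have no_two_isolated: False if "u \<in> P" "w \<in> P" "u \<noteq> w" "N u = {}" "N w = {}" for u w
    using no_universal_pair[OF that] le2 P7 by simp
  have le_oneE: "\<exists>b. A \<subseteq> {b}" if "card A \<le> 1" "finite A" for A :: "(real ^ 3) set"
    using that by (metis One_nat_def card_le_Suc0_iff_eq insertCI subsetI empty_iff insertI1)
  have leaf: False
    if x: "x \<in> P" "N x = {y}" and u: "u \<in> P" "card (N u) \<le> 1" "u \<noteq> x" "u \<noteq> y" for x y u
  proof -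
    have y: "y \<in> P" "x \<noteq> y" "x \<in> N y"
      using x gaps_subset[of x] not_self[of x] gaps_sym[of x y] by auto
    show False
    proof (cases "card (N y) = 2")
      case True
      then obtain w where w: "N y = {x, w}" "x \<noteq> w"
        using y by (elim card_two_with[of "N y" x]) auto
      then have wP: "w \<in> P" "w \<noteq> y" "y \<in> N w"
        using y gaps_subset[of y] not_self[of y] gaps_sym[of y w] by auto
      have "card (N w - {y}) \<le> 1"
        using le2[of w] wP by simp
      then obtain b where "N w - {y} \<subseteq> {b}"
        using le_oneE[of "N w - {y}"] by auto
      then show False
        using bound[of x y w b] x y w wP by auto
    next
      case False
      then have "card (N y) \<le> 1"
        using le2[of y] y by simp
      then have "N y = {x}"
        using le_oneE[of "N y"] y by auto
      moreover obtain b where "N u \<subseteq> {b}"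
        using u le_oneE[of "N u"] by auto
      ultimately show False
        using bound[of x y u b] x y u by auto
    qed
  qed
  have "card (D 0) \<le> 1"
    using no_two_isolated by (fastforce simp: card_le_Suc0_iff_eq in_D)
  then have few: "2 \<le> card (D 1)" "3 \<le> card (D 0) + card (D 1)"
    using counts by linarith+
  obtain x where "x \<in> D 1"
    using few(1) by fastforce
  then obtain y where x: "x \<in> P" "N x = {y}"
    by (auto simp: in_D card_1_singleton_iff)
  have "D 0 \<inter> D 1 = {}"
    by (auto simp: in_D)
  then have "3 \<le> card (D 0 \<union> D 1)"
    using few by (simp add: card_Un_disjoint)
  then have "\<not> D 0 \<union> D 1 \<subseteq> {x, y}"
    using card_mono[of "{x, y}" "D 0 \<union> D 1"] by (auto simp: card_insert_if split: if_splits)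
  then obtain u where "u \<in> D 0 \<union> D 1" "u \<noteq> x" "u \<noteq> y"
    by auto
  then show False
    using leaf[OF x, of u] by (auto simp: in_D)
qed

end

section \<open>Eight points with nine gaps\<close>

text \<open>A hypothetical packing with nineteen contacts, after \<open>gap_sum_seven\<close> has bounded the degrees.\<close>

locale dense_eight = packing +
  assumes card_P: "card P = 8" and gap_sum: "(\<Sum>p\<in>P. card (gaps P p)) = 18"
    and le_three: "\<And>p. p \<in> P \<Longrightarrow> card (gaps P p) \<le> 3"
begin

text \<open>For eight points, \<open>three_points_bound\<close> makes every three points have at least three outside
neighbors in the gap graph. This is the only way in which most of the following case analysis uses
geometry.\<close>

lemma expanding:
  assumes "distinct [x, y, z]" "x \<in> P" "y \<in> P" "z \<in> P" "N x \<union> N y \<union> N z \<subseteq> {x, y, z} \<union> {b, c}"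
  shows False
proof -
  have "card P \<le> card {b, c} + 5"
    using assms by (intro three_points_bound[of x y z]) auto
  moreover have "card {b, c} \<le> 2"
    by (simp add: card_insert_if)
  ultimately show False
    using card_P by simp
qed

lemma counts: "card (D 0) + card (D 1) + card (D 2) + card (D 3) = 8"
  "card (D 1) + 2 * card (D 2) + 3 * card (D 3) = 18"
  using degree_counts[OF le_three] card_P gap_sum by simp_all

lemma P_cases: "p \<in> D 0 \<or> p \<in> D 1 \<or> p \<in> D 2 \<or> p \<in> D 3" if "p \<in> P"
proof -
  have "card (N p) = 0 \<or> card (N p) = 1 \<or> card (N p) = 2 \<or> card (N p) = 3"
    using le_three[OF that] by linarith
  then show ?thesis
    using that by (auto simp: in_D)
qed

lemma gapD: "q \<in> P \<and> q \<noteq> p \<and> p \<in> N q" if "q \<in> N p" "p \<in> P"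
  using that gaps_subset[of p] not_self[of p] gaps_sym[of p q] by auto

lemma at_most_one_isolated: "card (D 0) \<le> 1"
proof -
  have False if "u \<in> P" "w \<in> P" "u \<noteq> w" "N u = {}" "N w = {}" for u w
    using no_universal_pair[OF that] le_three card_P by simp
  then show ?thesis
    by (fastforce simp: card_le_Suc0_iff_eq in_D)
qed

text \<open>A leaf \<open>x\<close> hangs on a point \<open>y\<close> of degree three whose other two neighbors have degree three and are
not joined by a gap. In every other case \<open>x\<close> and \<open>y\<close>, together with a suitable third point, have
at most two outside neighbors.\<close>

lemma leaf_structure:
  assumes D0: "D 0 = {}" and x: "x \<in> D 1"
  obtains y p q where "N x = {y}" "N y = {x, p, q}" "distinct [x, y, p, q]"
    "y \<in> D 3" "p \<in> D 3" "q \<in> D 3" "p \<notin> N q" "q \<notin> N p"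
proof -
  obtain y where Nx: "N x = {y}" and xP: "x \<in> P"
    using x by (auto simp: in_D card_1_singleton_iff)
  have y: "y \<in> P" "y \<noteq> x" "x \<in> N y"
    using gapD[of y x] Nx xP by auto
  have not1: "y \<notin> D 1"
  proof
    assume y1: "y \<in> D 1"
    then have Ny: "N y = {x}"
      using y by (auto simp: in_D card_1_singleton_iff)
    have "z \<in> D 3" if z: "z \<in> P - {x, y}" for z
    proof (rule ccontr)
      assume "z \<notin> D 3"
      then have "card (N z) \<le> 2"
        using le_three[of z] z by (auto simp: in_D)
      then obtain b c where "N z \<subseteq> {b, c}"
        using subset_two_if_card_le[of "N z"] by auto
      then show False
        using expanding[of x y z b c] Nx Ny xP y z by auto
    qed
    then have "card (P - {x, y}) \<le> card (D 3)"
      by (intro card_mono) auto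
    moreover have "card (P - {x, y}) = 6"
      using card_P xP y by simp
    moreover have "card {x, y} \<le> card (D 1)"
      using x y1 by (intro card_mono) auto
    ultimately show False
      using counts(2) y by simp
  qed
  have not2: "y \<notin> D 2"
  proof
    assume "y \<in> D 2"
    then obtain w where w: "N y = {x, w}" "x \<noteq> w"
      using y card_two_with[of "N y" x] by (auto simp: in_D)
    have w': "w \<in> P" "w \<noteq> y" "y \<in> N w"
      using gapD[of w y] w y by auto
    then have "card (N w - {y}) \<le> 2"
      using le_three[of w] by simp
    then obtain b c where "N w - {y} \<subseteq> {b, c}"
      using subset_two_if_card_le[of "N w - {y}"] by auto
    then show False
      using expanding[of x y w b c] Nx w w' xP y by auto
  qed
  have y3: "y \<in> D 3"
    using P_cases[OF y(1)] not1 not2 D0 by auto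
  then obtain p q where Ny: "N y = {x, p, q}" "distinct [x, p, q]"
    using card_three_with[of "N y" x] y by (auto simp: in_D)
  have branch: "p \<in> D 3 \<and> q \<notin> N p" if Ny: "N y = {x, p, q}" "distinct [x, p, q]" for p q
  proof (rule ccontr)
    assume neg: "\<not> (p \<in> D 3 \<and> q \<notin> N p)"
    have p: "p \<in> P" "p \<noteq> y" "y \<in> N p" and q: "q \<noteq> y"
      using gapD[of p y] gapD[of q y] Ny y by auto
    have "card (N p - {y, q}) \<le> 1"
    proof (cases "q \<in> N p")
      case True
      then have "card (N p - {y, q}) = card (N p) - card {y, q}"
        using p by (intro card_Diff_subset) auto
      then show ?thesis
        using le_three[of p] p q by simp
    next
      case False
      then have "card (N p) \<le> 2"
        using neg le_three[of p] p by (auto simp: in_D)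
      moreover have "N p - {y, q} = N p - {y}"
        using False by auto
      ultimately show ?thesis
        using p by simp
    qed
    then obtain b where "N p - {y, q} \<subseteq> {b}"
      using subset_one_if_card_le[of "N p - {y, q}"] by auto
    then show False
      using expanding[of x y p q b] Nx Ny xP y p by auto
  qed
  have "N y = {x, q, p}"
    using Ny by auto
  then show ?thesis
    using that[of y p q] Nx Ny y3 branch[of p q] branch[of q p] gapD[of _ y] y by auto
qed

text \<open>There are two points \<open>p\<close>, \<open>q\<close> of degree three and six of degree two, and the gap graph consists of
three paths of length three from \<open>p\<close> to \<open>q\<close>. The six inner points form an octahedron, and \<open>p\<close> and
\<open>q\<close> cap opposite faces.\<close>

lemma no_leaf_False:
  assumes D0: "D 0 = {}" and D1: "D 1 = {}"
  shows False
proof -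
  have c: "card (D 2) = 6" "card (D 3) = 2"
    using counts D0 D1 by auto
  obtain p q where D3: "D 3 = {p, q}" "p \<noteq> q"
    using c(2) by (auto simp: card_2_iff)
  have p: "p \<in> P" "card (N p) = 3" and q: "q \<in> P" "card (N q) = 3"
    using D3 by (auto simp: set_eq_iff in_D)
  have P_split: "z \<in> D 2 \<or> z = p \<or> z = q" if "z \<in> P" for z
    using P_cases[OF that] D0 D1 D3 by auto
  have pair: "\<exists>b'. N b \<subseteq> {a, b'}" if b: "b \<in> D 2" "a \<in> N b" for a b
  proof -
    have "card (N b) = 2"
      using b by (simp add: in_D)
    then obtain b' where "N b = {a, b'}"
      using b(2) by (elim card_two_with[of "N b" a])
    then show ?thesis
      by blast
  qed
  have "D 2 \<subseteq> N p \<union> N q"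
  proof
    fix a assume a: "a \<in> D 2"
    show "a \<in> N p \<union> N q"
    proof (rule ccontr)
      assume "a \<notin> N p \<union> N q"
      then have no: "p \<notin> N a" "q \<notin> N a"
        using a p q gaps_sym by (auto simp: in_D)
      obtain b c where bc: "N a = {b, c}" "b \<noteq> c"
        using a by (auto simp: in_D card_2_iff)
      have b: "b \<in> P" "b \<noteq> a" "a \<in> N b" "b \<in> D 2" and c: "c \<in> P" "c \<noteq> a" "a \<in> N c" "c \<in> D 2"
        using gapD[of b a] gapD[of c a] P_split[of b] P_split[of c] a bc no by (auto simp: in_D)
      obtain b' c' where "N b \<subseteq> {a, b'}" "N c \<subseteq> {a, c'}"
        using pair[of b a] pair[of c a] b c by auto
      then have "N a \<union> N b \<union> N c \<subseteq> {a, b, c} \<union> {b', c'}"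
        using bc(1) by blast
      with a b c bc(2) show False
        by (intro expanding[of a b c b' c']) (simp_all add: in_D)
    qed
  qed
  moreover have card_Un: "card (N p \<union> N q) + card (N p \<inter> N q) = 6"
    using card_Un_Int[of "N p" "N q"] p q by simp
  ultimately have D2: "D 2 = N p \<union> N q"
    using c(1) by (intro card_seteq) auto
  then have disj: "N p \<inter> N q = {}"
    using card_Un c(1) by simp
  have partner: "\<exists>a'. N a = {p, a'} \<and> N a' = {q, a} \<and> a' \<in> N q" if a: "a \<in> N p" for a
  proof -
    have a2: "a \<in> P" "a \<noteq> p" "p \<in> N a" "card (N a) = 2" "a \<notin> N q"
      using gapD[of a p] p a D2 disj by (auto simp: set_eq_iff in_D)
    obtain a' where a': "N a = {p, a'}" "p \<noteq> a'"
      using a2 by (elim card_two_with[of "N a" p]) auto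
    have a'P: "a' \<in> P" "a' \<noteq> a" "a \<in> N a'"
      using gapD[of a' a] a' a2 by auto
    have "a' \<noteq> q"
      using a2 a'P by auto
    then have "a' \<in> D 2"
      using P_split[OF a'P(1)] a'(2) by auto
    then have a'2: "card (N a') = 2" "a' \<in> N p \<or> a' \<in> N q"
      using D2 by (auto simp: set_eq_iff in_D)
    have "a' \<notin> N p"
    proof
      assume in_p: "a' \<in> N p"
      then have "p \<in> N a'"
        using gapD[of a' p] p by auto
      then have "N a' = {p, a}"
        using a'P a2 a'2 by (intro card_two_eq) auto
      moreover obtain d where "N p = {a, a', d}"
        using in_p a p a'P by (elim card_three_with_two[of "N p" a a']) auto
      ultimately have "N p \<union> N a \<union> N a' \<subseteq> {p, a, a'} \<union> {d, d}"
        using a' by blast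
      then show False
        using p a2 a'(2) a'P by (intro expanding[of p a a' d d]) auto
    qed
    then have in_q: "a' \<in> N q"
      using a'2 by simp
    then have "q \<in> N a'" "q \<noteq> a"
      using gapD[of a' q] gapD[of a p] q a p disj a2 D3 c D2 by (auto simp: in_D)
    then have "N a' = {q, a}"
      using a'P a'2 by (intro card_two_eq) auto
    then show ?thesis
      using a' in_q by (intro exI[of _ a']) simp
  qed
  obtain a b c where abc: "N p = {a, b, c}" "distinct [a, b, c]"
    using p by (auto simp: card_3_iff)
  have mem: "a \<in> N p" "b \<in> N p" "c \<in> N p"
    using abc(1) by simp_all
  obtain a' where a': "N a = {p, a'}" "N a' = {q, a}" "a' \<in> N q"
    using partner[OF mem(1)] by (elim exE conjE)
  obtain b' where b': "N b = {p, b'}" "N b' = {q, b}" "b' \<in> N q"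
    using partner[OF mem(2)] by (elim exE conjE)
  obtain c' where c': "N c = {p, c'}" "N c' = {q, c}" "c' \<in> N q"
    using partner[OF mem(3)] by (elim exE conjE)
  have not_pq: "p \<notin> D 2" "q \<notin> D 2"
    using p q by (auto simp: in_D)
  have distinct: "distinct [a, b, c, a', b', c']" "p \<notin> {a, b, c, a', b', c'}" "q \<notin> {a, b, c, a', b', c'}"
  proof -
    have "v \<noteq> v'" if "v \<in> N p" "v' \<in> N q" for v v'
      using that disj by auto
    moreover have "p \<notin> N p \<union> N q" "q \<notin> N p \<union> N q"
      using not_pq D2 by auto
    moreover have "a \<noteq> q" "b \<noteq> q" "c \<noteq> q"
      using mem calculation(3) by auto
    ultimately show "distinct [a, b, c, a', b', c']" "p \<notin> {a, b, c, a', b', c'}" "q \<notin> {a, b, c, a', b', c'}"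
      using abc(2) mem a'(2,3) b'(2,3) c'(2,3) by (auto simp: doubleton_eq_iff)
  qed
  have in_P: "{a, b, c, a', b', c'} \<subseteq> P"
    using mem a'(3) b'(3) c'(3) gaps_subset[of p] gaps_subset[of q] by auto
  have "N q = {a', b', c'}"
    using card_seteq[of "N q" "{a', b', c'}"] q a' b' c' distinct by auto
  note N = this abc(1) a'(1,2) b'(1,2) c'(1,2)
  have "octahedron a a' b b' c c'"
    unfolding octahedron_def by (intro conjI touch; use distinct in_P N in auto)
  moreover have "dist q a = 2" "dist q b = 2" "dist q c = 2" "dist p a' = 2" "dist p b' = 2"
    "dist p c' = 2" "dist p q = 2"
    by (rule touch; use distinct in_P N p q D3(2) in auto)+
  moreover have "2 \<le> dist q a'" "2 \<le> dist p a"
    by (rule separated; use distinct in_P p q in auto)+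
  ultimately show False
    using octahedron_caps_apart(1) by blast
qed

lemma D3_eqI:
  assumes "card (D 3) = card A" "A \<subseteq> D 3"
  shows "D 3 = A"
  using card_seteq[of "D 3" A] assms by simp

text \<open>The gap graph consists of two paths of length three from \<open>p\<close> to \<open>q\<close>, a path from \<open>p\<close> to \<open>q\<close> through
\<open>y\<close>, and the leaf \<open>x\<close> at \<open>y\<close>. Together with \<open>x\<close> and \<open>y\<close>, the four points of degree two form an
octahedron, and \<open>p\<close> and \<open>q\<close> cap faces that share the corner \<open>x\<close>.\<close>

lemma one_leaf_False:
  assumes D0: "D 0 = {}" and D1: "card (D 1) = 1"
  shows False
proof -
  have c: "card (D 2) = 4" "card (D 3) = 3"
    using counts D0 D1 by auto
  obtain x where x: "D 1 = {x}"
    using D1 by (auto simp: card_1_singleton_iff)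
  then obtain y p q where Nx: "N x = {y}" and Ny: "N y = {x, p, q}" and ne: "distinct [x, y, p, q]"
    and D3s: "y \<in> D 3" "p \<in> D 3" "q \<in> D 3" and npq: "p \<notin> N q" "q \<notin> N p"
    using leaf_structure[OF D0, of x] by blast
  have D3: "D 3 = {y, p, q}"
    using c ne D3s by (intro D3_eqI) auto
  have P: "x \<in> P" "y \<in> P" "p \<in> P" "q \<in> P" and card_pq: "card (N p) = 3" "card (N q) = 3"
    using x D3s by (auto simp: set_eq_iff in_D)
  have P_split: "z \<in> {x, y, p, q} \<or> z \<in> D 2" if "z \<in> P" for z
    using P_cases[OF that] D0 x D3 by auto
  have not_D2: "x \<notin> D 2" "y \<notin> D 2" "p \<notin> D 2" "q \<notin> D 2"
    using D3s x by (auto simp: set_eq_iff in_D)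
  have yN: "y \<in> N p" "y \<in> N q"
    using gapD[of p y] gapD[of q y] Ny P by auto
  have N_pq: "N p \<subseteq> insert y (D 2)" "N q \<subseteq> insert y (D 2)"
  proof -
    have "z \<in> insert y (D 2)" if z: "z \<in> N v" and v: "v \<in> {p, q}" for z v
    proof -
      have "z \<in> P" "v \<in> N z"
        using gapD[OF z] v P by auto
      moreover have "z \<noteq> x"
      proof
        assume "z = x"
        then have "v = y"
          using \<open>v \<in> N z\<close> Nx by simp
        then show False
          using v ne by simp
      qed
      moreover have "z \<notin> {p, q}"
        using z v npq not_self by auto
      ultimately show ?thesis
        using P_split[of z] by simp
    qed
    then show "N p \<subseteq> insert y (D 2)" "N q \<subseteq> insert y (D 2)"
      by auto
  qed
  have N_D2: "N z \<subseteq> {p, q} \<union> D 2" if "z \<in> D 2" for z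
  proof
    fix v assume v: "v \<in> N z"
    then have v': "v \<in> P" "z \<in> N v"
      using gapD[OF v] that by (auto simp: in_D)
    have "z \<notin> {x, y, p, q}"
      using that not_D2 by auto
    then have "z \<notin> N x" "z \<notin> N y"
      unfolding Nx Ny by auto
    then show "v \<in> {p, q} \<union> D 2"
      using P_split[of v] v' by auto
  qed
  \<comment> \<open>A common neighbor \<open>r\<close> of \<open>p\<close> and \<open>q\<close> would leave the other three points of degree two with \<open>p\<close> and \<open>q\<close> as their only outside neighbors.\<close>
  have disj: "N p \<inter> N q = {y}"
  proof (rule ccontr)
    assume "N p \<inter> N q \<noteq> {y}"
    then obtain r where r: "r \<in> N p" "r \<in> N q" "r \<noteq> y"
      using yN by auto
    then have rD: "r \<in> D 2" "p \<in> N r" "q \<in> N r"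
      using N_pq gapD[of r p] gapD[of r q] P by auto
    then have Nr: "N r = {p, q}"
      using ne by (intro card_two_eq) (auto simp: in_D)
    have "card (D 2 - {r}) = 3"
      using rD c by simp
    then obtain s t w where stw: "D 2 - {r} = {s, t, w}" "distinct [s, t, w]"
      by (auto simp: card_3_iff)
    have sub: "N v \<subseteq> {s, t, w} \<union> {p, q}" if "v \<in> {s, t, w}" for v
    proof -
      have "v \<in> D 2 - {r}"
        unfolding stw(1) by (rule that)
      then have v: "v \<in> D 2" "v \<in> P" "v \<notin> {p, q}"
        using not_D2 by (auto simp: in_D)
      have "r \<notin> N v"
        using gapD[of r v] v(2,3) unfolding Nr by blast
      then have "N v \<subseteq> {p, q} \<union> (D 2 - {r})"
        using N_D2[OF v(1)] by blast
      then show ?thesis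
        unfolding stw(1) by blast
    qed
    have "N s \<union> N t \<union> N w \<subseteq> {s, t, w} \<union> {p, q}"
      by (intro Un_least sub) simp_all
    moreover have "{s, t, w} \<subseteq> P"
      unfolding stw(1)[symmetric] by (auto simp: in_D)
    ultimately show False
      using stw(2) by (intro expanding[of s t w p q]) auto
  qed
  obtain r s where rs: "N p = {y, r, s}" "distinct [y, r, s]"
    using card_three_with[of "N p" y] card_pq yN by auto
  obtain t u where tu: "N q = {y, t, u}" "distinct [y, t, u]"
    using card_three_with[of "N q" y] card_pq yN by auto
  have in_D2: "{r, s, t, u} \<subseteq> D 2" and d4: "distinct [r, s, t, u]"
    using N_pq rs tu disj by auto
  then have D2: "D 2 = {r, s, t, u}"
    using card_seteq[of "D 2" "{r, s, t, u}"] c by auto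
  have in_P: "{r, s, t, u} \<subseteq> P" and distinct: "x \<notin> {r, s, t, u}" "y \<notin> {r, s, t, u}"
    "p \<notin> {r, s, t, u}" "q \<notin> {r, s, t, u}"
    using in_D2 not_D2 by (auto simp: in_D)
  have no_triangle: "s \<notin> N r"
    if r: "N v = {y, r, s}" "distinct [y, r, s]" "v = p \<or> v = q" "{r, s} \<subseteq> D 2" for v r s
  proof
    assume "s \<in> N r"
    moreover have "r \<in> P" "s \<in> P" "v \<in> P" "card (N r) = 2" "card (N s) = 2" "v \<noteq> s" "v \<noteq> r"
      using r P not_D2 by (auto simp: in_D)
    moreover have "v \<in> N r" "v \<in> N s" "r \<in> N s"
      using calculation gapD[of s r] gapD[of r v] gapD[of s v] r(1) by auto
    ultimately have "N r = {v, s}" "N s = {v, r}"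
      using card_two_eq[of "N r" v s] card_two_eq[of "N s" v r] by simp_all
    then have "N v \<union> N r \<union> N s \<subseteq> {v, r, s} \<union> {y, y}"
      using r(1) by blast
    moreover have "v \<in> P" "r \<in> P" "s \<in> P" "v \<noteq> r" "v \<noteq> s"
      using r P not_D2 by (auto simp: in_D)
    ultimately show False
      using r(2) by (intro expanding[of v r s y y]) auto
  qed
  have rs': "s \<notin> N r" "r \<notin> N s" and tu': "u \<notin> N t" "t \<notin> N u"
    using no_triangle[of p r s] no_triangle[of p s r] no_triangle[of q t u] no_triangle[of q u t]
      rs tu in_D2 by auto
  have finish: False
    if t: "N q = {y, t, u}" "distinct [r, s, t, u]" "{r, s, t, u} \<subseteq> D 2" "D 2 = {r, s, t, u}"
      "u \<notin> N t" "t \<notin> N u" "t \<in> N r" for t u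
  proof -
    have pr: "p \<in> N r" and qt: "q \<in> N t"
      using gapD[of r p] gapD[of t q] rs(1) t(1) P by auto
    have tr: "r \<in> N t"
      using gapD[of t r] t(7) in_P by auto
    have two: "card (N r) = 2" "card (N t) = 2"
      using t(3) by (auto simp: in_D)
    have ne': "p \<noteq> t" "q \<noteq> r"
      using t(3) not_D2 by auto
    have Nr: "N r = {p, t}" and Nt: "N t = {q, r}"
      by (intro card_two_eq two pr qt tr t(7) ne')+
    have away: "{r, s, t, u} \<subseteq> P" "x \<notin> {r, s, t, u}" "y \<notin> {r, s, t, u}" "p \<notin> {r, s, t, u}"
      "q \<notin> {r, s, t, u}"
      using t(3) not_D2 by (auto simp: in_D)
    have "s \<notin> N t" "u \<notin> N r"
      using Nr Nt t(2) away(4,5) by auto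
    then have not_gap: "t \<notin> N s" "r \<notin> N u"
      using gapD[of t s] gapD[of r u] away by auto
    have not_gap_pq: "x \<notin> N p" "x \<notin> N q"
      using gapD[of x p] gapD[of x q] Nx P ne by auto
    note N = Nx Ny Nr Nt t(1) rs(1)
    have "octahedron x y r t s u"
      unfolding octahedron_def
      by (intro conjI touch; use N not_gap away t(2) P ne in auto)
    moreover have "dist q x = 2" "dist q r = 2" "dist q s = 2" "dist p x = 2" "dist p t = 2" "dist p u = 2"
      "dist p q = 2"
      by (rule touch; use N away t(2) P ne npq not_gap_pq in auto)+
    moreover have "2 \<le> dist q y" "2 \<le> dist p y"
      by (rule separated; use P ne in auto)+
    ultimately show False
      using octahedron_caps_apart(2) by blast
  qed
  have "p \<in> N r" "q \<notin> N r"
    using gapD[of r p] gapD[of q r] rs tu d4 distinct in_P P by auto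
  moreover have "card (N r) = 2" "r \<in> D 2"
    using in_D2 by (auto simp: in_D)
  ultimately obtain v where "N r = {p, v}" "p \<noteq> v"
    by (elim card_two_with[of "N r" p]) auto
  then have "v \<in> {t, u}"
    using N_D2[OF \<open>r \<in> D 2\<close>] \<open>q \<notin> N r\<close> D2 rs'(1) not_self[of r] by auto
  then show False
    using finish[of t u] finish[of u t] tu tu' d4 D2 \<open>N r = {p, v}\<close> by auto
qed

text \<open>The stems \<open>y\<close> and \<open>y'\<close> of the two leaves are not joined by a gap. So both are joined to the other two
points \<open>p\<close>, \<open>q\<close> of degree three, which have one further neighbor \<open>r\<close> and \<open>s\<close> each. The pairs
\<open>(x, y)\<close>, \<open>(x', y')\<close> and \<open>(r, s)\<close> are the diagonals of an octahedron, and \<open>p\<close> and \<open>q\<close> cap faces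
that share the edge from \<open>x\<close> to \<open>x'\<close>.\<close>

lemma two_leaves_False:
  assumes D0: "D 0 = {}" and D1: "card (D 1) = 2"
  shows False
proof -
  have c: "card (D 2) = 2" "card (D 3) = 4"
    using counts D0 D1 by auto
  obtain x x' where x: "D 1 = {x, x'}" "x \<noteq> x'"
    using D1 by (auto simp: card_2_iff)
  obtain y p q where Nx: "N x = {y}" and Ny: "N y = {x, p, q}" and ne: "distinct [x, y, p, q]"
    and D3s: "y \<in> D 3" "p \<in> D 3" "q \<in> D 3" and npq: "p \<notin> N q" "q \<notin> N p"
    using leaf_structure[OF D0, of x] x(1) by blast
  obtain y' p' q' where Nx': "N x' = {y'}" and Ny': "N y' = {x', p', q'}" and ne': "distinct [x', y', p', q']"
    and D3s': "y' \<in> D 3" "p' \<in> D 3" "q' \<in> D 3" and npq': "p' \<notin> N q'" "q' \<notin> N p'"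
    using leaf_structure[OF D0, of x'] x(1) by blast
  have not_D: "v \<noteq> w" if "v \<in> D i" "w \<in> D j" "i \<noteq> j" for v w i j
    using that by (auto simp: in_D)
  have P_D: "v \<in> P" if "v \<in> D i" for v i
    using that by (simp add: in_D)
  have leaves: "x \<in> D 1" "x' \<in> D 1"
    using x by auto
  have P: "x \<in> P" "x' \<in> P" "y \<in> P" "y' \<in> P" "p \<in> P" "q \<in> P" "p' \<in> P" "q' \<in> P"
    using leaves D3s D3s' by (auto simp: in_D)
  have "x' \<noteq> p" "x' \<noteq> q" "x' \<noteq> y" "x \<noteq> p'" "x \<noteq> q'" "x \<noteq> y'"
    using not_D[OF leaves(2) D3s(1)] not_D[OF leaves(2) D3s(2)] not_D[OF leaves(2) D3s(3)]
      not_D[OF leaves(1) D3s'(1)] not_D[OF leaves(1) D3s'(2)] not_D[OF leaves(1) D3s'(3)]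
    by simp_all
  note ne_leaf = this x(2)
  have yy': "y \<noteq> y'"
    using Ny Ny' ne_leaf by auto
  \<comment> \<open>If \<open>y\<close> and \<open>y'\<close> were joined, the third neighbor \<open>r\<close> of \<open>y\<close> and the two points of degree two would have at most \<open>y\<close> and the third neighbor \<open>s\<close> of \<open>y'\<close> outside.\<close>
  have far: "y' \<notin> N y"
  proof
    assume "y' \<in> N y"
    then obtain r where r: "N y = {x, y', r}" "r \<notin> N y'" "r \<in> D 3" "r \<noteq> y" "r \<noteq> y'"
    proof (cases "y' = p")
      case True
      then show ?thesis
        using that[of q] Ny npq D3s ne by auto
    next
      case False
      then have "y' = q"
        using \<open>y' \<in> N y\<close> Ny ne_leaf by auto
      then show ?thesis
        using that[of p] Ny npq D3s ne by auto
    qed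
    have "y \<in> N y'"
      using gapD[OF \<open>y' \<in> N y\<close>] P by simp
    then obtain s where s: "N y' = {x', y, s}" "s \<notin> N y" "s \<in> D 3" "s \<noteq> y'" "s \<noteq> y"
    proof (cases "y = p'")
      case True
      then show ?thesis
        using that[of q'] Ny' npq' D3s' ne' by auto
    next
      case False
      then have "y = q'"
        using \<open>y \<in> N y'\<close> Ny' ne_leaf by auto
      then show ?thesis
        using that[of p'] Ny' npq' D3s' ne' by auto
    qed
    have "r \<noteq> s"
      using r(1) s(2) by auto
    then have D3: "D 3 = {y, y', r, s}"
      using c yy' r s D3s D3s' by (intro D3_eqI) auto
    obtain a b where D2: "D 2 = {a, b}" "a \<noteq> b"
      using c by (auto simp: card_2_iff)
    have ab: "a \<in> D 2" "b \<in> D 2"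
      using D2 by auto
    have sub: "N v \<subseteq> {r, a, b} \<union> {y, s}" if v: "v \<in> {r, a, b}" for v
    proof
      fix w assume w: "w \<in> N v"
      have "v \<in> D 2 \<or> v = r"
        using v ab by auto
      then have vP: "v \<in> P" and "v \<notin> {x, x', y, y', s}"
        using not_D[of v 2] leaves D3s D3s' r s \<open>r \<noteq> s\<close> not_D[of r 3] by (auto simp: in_D)
      then have "v \<notin> N x" "v \<notin> N x'" "v \<notin> N y'"
        unfolding Nx Nx' s(1) by auto
      moreover have "w \<in> P" "v \<in> N w"
        using gapD[OF w vP] by auto
      ultimately show "w \<in> {r, a, b} \<union> {y, s}"
        using P_cases[of w] D0 x(1) D2(1) D3 by auto
    qed
    have "N r \<union> N a \<union> N b \<subseteq> {r, a, b} \<union> {y, s}"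
      by (intro Un_least sub) simp_all
    moreover have "r \<noteq> a" "r \<noteq> b"
      using not_D[OF r(3) ab(1)] not_D[OF r(3) ab(2)] by simp_all
    ultimately show False
      using D2(2) P_D[OF ab(1)] P_D[OF ab(2)] P_D[OF r(3)] by (intro expanding[of r a b y s]) simp_all
  qed
  have "D 3 = {y, y', p, q}"
    using c ne D3s D3s' yy' far Ny by (intro D3_eqI) auto
  moreover have "p' \<notin> {y, y'}" "q' \<notin> {y, y'}"
    using gapD[of p' y'] gapD[of q' y'] far Ny' P ne' by auto
  ultimately have pq': "p' \<in> {p, q}" "q' \<in> {p, q}"
    using D3s' by auto
  then have Ny'_eq: "N y' = {x', p, q}"
    using Ny' ne' by auto
  have D3: "D 3 = {y, y', p, q}"
    by fact
  have yN: "y \<in> N v" "y' \<in> N v" if "v \<in> {p, q}" for v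
    using gapD[of v y] gapD[of v y'] that Ny Ny'_eq P by auto
  have third: "\<exists>r. N v = {y, y', r} \<and> r \<in> D 2" if v: "v \<in> {p, q}" for v
  proof -
    have v': "v \<in> P" "card (N v) = 3" "v \<notin> {y, y'}"
      using v D3s ne gapD[of v y'] Ny'_eq P by (auto simp: in_D)
    then obtain r where r: "N v = {y, y', r}" "r \<noteq> y" "r \<noteq> y'"
      using yN[OF v] yy' by (elim card_three_with_two[of "N v" y y']) auto
    then have "r \<in> P" "v \<in> N r"
      using gapD[of r v] v' by auto
    moreover have "r \<notin> {x, x'}"
      using \<open>v \<in> N r\<close> Nx Nx' v'(3) by auto
    moreover have "r \<notin> {p, q}"
      using r(1) v npq not_self by blast
    ultimately show ?thesis
      using P_cases[of r] D0 x(1) D3 r by auto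
  qed
  obtain r where r: "N p = {y, y', r}" "r \<in> D 2"
    using third[of p] by auto
  obtain s where s: "N q = {y, y', s}" "s \<in> D 2"
    using third[of q] by auto
  have rs_ne: "v \<notin> {x, x', y, y', p, q}" if "v \<in> D 2" for v
    using that leaves D3s D3s' by (auto simp: in_D)
  have "r \<noteq> s"
  proof
    assume "r = s"
    have "r \<in> P" "card (N r) = 2"
      using r by (auto simp: in_D)
    moreover have "p \<in> N r" "q \<in> N r"
      using gapD[of r p] gapD[of r q] r s P \<open>r = s\<close> by auto
    ultimately have Nr: "N r = {p, q}"
      using ne by (intro card_two_eq) auto
    have "card (D 2 - {r}) = 1"
      using c r by simp
    then obtain w where w: "D 2 - {r} = {w}"
      by (auto simp: card_1_singleton_iff)
    then have w2: "w \<in> D 2" "w \<noteq> r"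
      by auto
    have "v \<notin> N w" for v
    proof
      assume v: "v \<in> N w"
      then have "v \<in> P" "w \<in> N v" "v \<noteq> w"
        using gapD[of v w] w2 by (auto simp: in_D)
      moreover have "w \<notin> N x" "w \<notin> N x'" "w \<notin> N y" "w \<notin> N y'" "w \<notin> N p" "w \<notin> N q" "w \<notin> N r"
        unfolding Nx Nx' Ny Ny'_eq r(1) s(1) Nr using rs_ne[OF w2(1)] w2(2) \<open>r = s\<close> by auto
      moreover have "D 2 = {r, w}"
        using w r(2) by auto
      ultimately show False
        using P_cases[of v] D0 x(1) D3 by auto
    qed
    then have "N w = {}"
      by blast
    then show False
      using w2 by (simp add: in_D)
  qed
  have P': "r \<in> P" "s \<in> P"
    using r s by (auto simp: in_D)
  have away: "r \<notin> {x, x', y, y', p, q}" "s \<notin> {x, x', y, y', p, q}"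
    using rs_ne r s by auto
  have ne2: "x' \<noteq> y'" "p \<noteq> y'" "q \<noteq> y'"
    using ne' Ny far by auto
  have "r \<notin> N y'" "s \<notin> N x'" "x \<notin> N p" "x \<notin> N q" "x' \<notin> N p" "x' \<notin> N q"
    using Ny'_eq r(1) s(1) Nx' away ne ne2 ne_leaf by auto
  then have not_gap: "y' \<notin> N r" "x' \<notin> N s"
    using gapD[of y' r] gapD[of x' s] P' by auto
  note N = Nx Ny Nx' Ny'_eq r(1) s(1)
  have "octahedron x y x' y' r s"
    unfolding octahedron_def
    by (intro conjI touch; use N not_gap away \<open>r \<noteq> s\<close> P P' ne ne2 ne_leaf yy' in auto)
  moreover have "dist q x = 2" "dist q x' = 2" "dist q r = 2" "dist p x = 2" "dist p x' = 2" "dist p s = 2"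
    "dist p q = 2"
    by (rule touch; use N away \<open>r \<noteq> s\<close> P P' ne ne2 ne_leaf npq in auto)+
  moreover have "2 \<le> dist q y" "2 \<le> dist p y"
    by (rule separated; use P ne in auto)+
  ultimately show False
    using octahedron_caps_apart(3) by blast
qed

text \<open>There are no points of degree two. The three leaves and the two points \<open>p\<close>, \<open>q\<close> of degree three that
carry no leaf touch pairwise. If \<open>p\<close> and \<open>q\<close> were joined by a gap, they would have a stem as a
common neighbor, against \<open>leaf_structure\<close>.\<close>

lemma three_leaves_False:
  assumes D0: "D 0 = {}" and D1: "card (D 1) = 3"
  shows False
proof -
  have "card (D 0) = 0"
    using D0 by simp
  then have c: "card (D 2) = 0" "card (D 3) = 5"
    using counts D1 by linarith+
  then have D2: "D 2 = {}"
    by simp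
  obtain x1 x2 x3 where x: "D 1 = {x1, x2, x3}" "distinct [x1, x2, x3]"
    using D1 by (auto simp: card_3_iff)
  define stem where "stem x y \<longleftrightarrow> N x = {y} \<and> y \<in> D 3
      \<and> (\<forall>p \<in> N y - {x}. \<forall>q \<in> N y - {x}. q \<notin> N p) \<and> N y \<inter> D 1 \<subseteq> {x}" for x y
  have stem_ex: "\<exists>y. stem x y" if x: "x \<in> D 1" for x
  proof -
    obtain y p q where y: "N x = {y}" "N y = {x, p, q}" "y \<in> D 3" "p \<in> D 3" "q \<in> D 3"
      "p \<notin> N q" "q \<notin> N p"
      using leaf_structure[OF D0 x] by metis
    have "\<forall>v \<in> N y - {x}. \<forall>w \<in> N y - {x}. w \<notin> N v"
      using y(2,6,7) not_self by auto
    moreover have "p \<notin> D 1" "q \<notin> D 1"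
      using y(4,5) by (auto simp: in_D)
    then have "N y \<inter> D 1 \<subseteq> {x}"
      using y(2) by auto
    ultimately have "stem x y"
      unfolding stem_def using y(1,3) by blast
    then show ?thesis
      by (rule exI)
  qed
  have xD: "x1 \<in> D 1" "x2 \<in> D 1" "x3 \<in> D 1"
    using x by auto
  obtain y1 y2 y3 where stems: "stem x1 y1" "stem x2 y2" "stem x3 y3"
    using stem_ex[OF xD(1)] stem_ex[OF xD(2)] stem_ex[OF xD(3)] by (elim exE)
  have stemD: "N x = {y}" "y \<in> D 3" "\<And>p q. p \<in> N y \<Longrightarrow> q \<in> N y \<Longrightarrow> p \<noteq> x \<Longrightarrow> q \<noteq> x \<Longrightarrow> q \<notin> N p"
    "\<And>z. z \<in> D 1 \<Longrightarrow> z \<in> N y \<Longrightarrow> z = x" if "stem x y" for x y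
    using that unfolding stem_def by blast+
  note y1 = stemD[OF stems(1)] and y2 = stemD[OF stems(2)] and y3 = stemD[OF stems(3)]
  have P: "x1 \<in> P" "x2 \<in> P" "x3 \<in> P" "y1 \<in> P" "y2 \<in> P" "y3 \<in> P"
    using xD y1(2) y2(2) y3(2) by (auto simp: in_D)
  have "x1 \<in> N y1" "x2 \<in> N y2" "x3 \<in> N y3"
    using gapD[of y1 x1] gapD[of y2 x2] gapD[of y3 x3] P y1(1) y2(1) y3(1) by auto
  note xN = this
  have stems_ne: "y \<noteq> y'" if "stem x y" "x' \<in> N y'" "x' \<in> D 1" "x \<noteq> x'" for x x' y y'
    using stemD(4)[OF that(1) that(3)] that(2,4) by metis
  have y_ne: "distinct [y1, y2, y3]"
    using stems_ne[OF stems(1) xN(2) xD(2)] stems_ne[OF stems(1) xN(3) xD(3)]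
      stems_ne[OF stems(2) xN(3) xD(3)] x(2) by simp
  have "card (D 3 - {y1, y2, y3}) = 2"
    using y_ne c y1(2) y2(2) y3(2) by simp
  then obtain p q where pq: "D 3 - {y1, y2, y3} = {p, q}" "p \<noteq> q"
    by (auto simp: card_2_iff)
  then have pq': "p \<in> D 3 - {y1, y2, y3}" "q \<in> D 3 - {y1, y2, y3}" and
    D3: "\<And>v. v \<in> D 3 \<Longrightarrow> v \<in> {y1, y2, y3, p, q}"
    by blast+
  have "q \<notin> N p"
  proof
    assume qp: "q \<in> N p"
    then have "p \<in> N q"
      using gapD[of q p] pq'(1) by (auto simp: in_D)
    have rest: "N v - {w} \<subseteq> {y1, y2, y3} \<and> card (N v - {w}) = 2"
      if "w \<in> N v" "{v, w} = {p, q}" for v w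
    proof -
      have v: "v \<in> D 3" "v \<notin> {y1, y2, y3}"
        using that(2) pq' by (auto simp: doubleton_eq_iff)
      have "z \<in> {y1, y2, y3}" if z: "z \<in> N v" "z \<noteq> w" for z
      proof -
        have z': "z \<in> P" "z \<noteq> v" "v \<in> N z"
          using gapD[of z v] z v by (auto simp: in_D)
        then have "z \<notin> D 1"
          using x(1) y1(1) y2(1) y3(1) v by auto
        then have "z \<in> D 3"
          using P_cases[OF z'(1)] D0 D2 by simp
        then show ?thesis
          using D3[of z] z'(2) z(2) \<open>{v, w} = {p, q}\<close> by (auto simp: doubleton_eq_iff)
      qed
      then show ?thesis
        using v(1) that(1) by (auto simp: in_D)
    qed
    have rest_p: "N p - {q} \<subseteq> {y1, y2, y3}" "card (N p - {q}) = 2"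
      and rest_q: "N q - {p} \<subseteq> {y1, y2, y3}" "card (N q - {p}) = 2"
      using rest[OF qp] rest[OF \<open>p \<in> N q\<close>] by (simp_all add: insert_commute)
    have "card ((N p - {q}) \<union> (N q - {p})) \<le> card {y1, y2, y3}"
      using rest_p rest_q by (intro card_mono) auto
    moreover have "card {y1, y2, y3} = 3"
      using y_ne by simp
    moreover have "card (N p - {q}) + card (N q - {p}) =
        card ((N p - {q}) \<union> (N q - {p})) + card ((N p - {q}) \<inter> (N q - {p}))"
      by (intro card_Un_Int) simp_all
    ultimately have "card ((N p - {q}) \<inter> (N q - {p})) \<noteq> 0"
      using rest_p(2) rest_q(2) by linarith
    then have "(N p - {q}) \<inter> (N q - {p}) \<noteq> {}"
      by (metis card.empty)
    then obtain y where y: "y \<in> N p" "y \<in> N q" "y \<in> {y1, y2, y3}"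
      using rest_p(1) by blast
    have "p \<in> P" "q \<in> P" and leaf_ne: "p \<notin> {x1, x2, x3}" "q \<notin> {x1, x2, x3}"
      using pq' xD by (auto simp: in_D)
    then have "p \<in> N y" "q \<in> N y"
      using gapD[OF y(1)] gapD[OF y(2)] by blast+
    moreover obtain x where "stem x y" "x \<in> {x1, x2, x3}"
      using y(3) stems by blast
    ultimately show False
      using stemD(3)[of x y p q] leaf_ne qp by blast
  qed
  moreover have "p \<notin> {x1, x2, x3}" "q \<notin> {x1, x2, x3}" "p \<in> P" "q \<in> P"
    using pq' xD by (auto simp: in_D)
  moreover have "y1 \<notin> {x1, x2, x3}" "y2 \<notin> {x1, x2, x3}"
    using y1(2) y2(2) xD by (auto simp: in_D)
  ultimately show False
    using pq(2) pq' P x(2) y1(1) y2(1) y3(1) by (intro no_K5[of x1 x2 x3 p q]) auto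
qed

lemma touch_sym: "dist p q = 2" if "p \<in> P" "q \<in> P" "p \<noteq> q" "p \<notin> N q"
  using touch[of q p] that by (simp add: dist_commute)

text \<open>Let \<open>u\<close> be the isolated point. There are three points of degree two, which form a tetrahedron with
\<open>u\<close>, and four points of degree three. Each point of degree two has its two neighbors among those
four, the two neighbors touch, and different points of degree two have different pairs of neighbors.
So three edges are drawn on four points, two of which meet, and up to symmetry they form a triangle,
a star or a path. For a triangle, the fourth point touches the whole tetrahedron; the other two
shapes are those of \<open>no_contact_closes_star\<close> and \<open>no_contact_closes_strip\<close>.\<close>

lemma isolated_False:
  assumes D0: "card (D 0) = 1"
  shows False
proof -
  obtain u where u: "D 0 = {u}"
    using D0 by (auto simp: card_1_singleton_iff)
  then have "u \<in> D 0"
    by simp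
  then have uP: "u \<in> P" and Nu: "N u = {}"
    by (simp_all add: in_D)
  have D1: "D 1 = {}"
  proof (rule ccontr)
    assume "D 1 \<noteq> {}"
    then obtain x where "x \<in> D 1"
      by auto
    then obtain y where x: "x \<in> P" "N x = {y}"
      by (auto simp: in_D card_1_singleton_iff)
    then have y: "y \<in> P" "y \<noteq> x" "x \<in> N y"
      using gapD[of y x] by auto
    then have "card (N y - {x}) \<le> 2"
      using le_three[of y] by simp
    then obtain b c where "N y - {x} \<subseteq> {b, c}"
      using subset_two_if_card_le[of "N y - {x}"] by auto
    then have "N u \<union> N x \<union> N y \<subseteq> {u, x, y} \<union> {b, c}"
      unfolding Nu x(2) by blast
    moreover have "u \<noteq> x" "u \<noteq> y"
      using Nu x y by auto
    ultimately show False
      using x y uP by (intro expanding[of u x y b c]) simp_all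
  qed
  then have "card (D 1) = 0"
    by simp
  then have c: "card (D 2) = 3" "card (D 3) = 4"
    using counts D0 by linarith+
  have P_D: "v \<in> P" if "v \<in> D i" for v i
    using that by (simp add: in_D)
  have not_D: "v \<noteq> w" if "v \<in> D i" "w \<in> D j" "i \<noteq> j" for v w i j
    using that by (auto simp: in_D)
  have ends: "q \<in> D 3 \<and> p \<notin> N q" if a: "a \<in> D 2" "N a = {p, q}" "p \<noteq> q" for a p q
  proof (rule ccontr)
    assume neg: "\<not> (q \<in> D 3 \<and> p \<notin> N q)"
    have q: "q \<in> P" "q \<noteq> a" "a \<in> N q" and p: "p \<noteq> a"
      using gapD[of q a] gapD[of p a] a P_D by auto
    have "card (N q - {a, p}) \<le> 1"
    proof (cases "p \<in> N q")
      case True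
      then have "card (N q - {a, p}) = card (N q) - card {a, p}"
        using q by (intro card_Diff_subset) auto
      then show ?thesis
        using le_three[of q] p q by simp
    next
      case False
      then have "q \<notin> D 3"
        using neg by simp
      then have "card (N q) \<le> 2"
        using le_three[of q] q(1) by (simp add: in_D)
      moreover have "N q - {a, p} = N q - {a}"
        using False by auto
      ultimately show ?thesis
        using q by simp
    qed
    then obtain b where "N q - {a, p} \<subseteq> {b}"
      using subset_one_if_card_le[of "N q - {a, p}"] by auto
    then have "N u \<union> N a \<union> N q \<subseteq> {u, a, q} \<union> {p, b}"
      unfolding Nu a(2) by blast
    moreover have "u \<noteq> a" "u \<noteq> q"
      using Nu a q by auto
    ultimately show False
      using a q uP P_D[OF a(1)] by (intro expanding[of u a q p b]) simp_all
  qed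
  have pair: "p \<in> D 3" "q \<in> D 3" "p \<notin> N q" "q \<notin> N p"
    if "a \<in> D 2" "N a = {p, q}" "p \<noteq> q" for a p q
    using ends[of a p q] ends[of a q p] that by (simp_all add: insert_commute)
  have N_sub: "N a \<subseteq> D 3" if a: "a \<in> D 2" for a
  proof -
    obtain p q where "N a = {p, q}" "p \<noteq> q"
      using a by (auto simp: in_D card_2_iff)
    then show ?thesis
      using pair[OF a] by simp
  qed
  have N_inj: "N a \<noteq> N b" if ab: "a \<in> D 2" "b \<in> D 2" "a \<noteq> b" for a b
  proof
    assume eq: "N a = N b"
    obtain p q where "N a = {p, q}"
      using ab(1) by (auto simp: in_D card_2_iff)
    then have "N u \<union> N a \<union> N b \<subseteq> {u, a, b} \<union> {p, q}"
      unfolding Nu eq[symmetric] by blast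
    then show False
      using ab uP P_D[OF ab(1)] P_D[OF ab(2)] not_D[OF \<open>u \<in> D 0\<close> ab(1)] not_D[OF \<open>u \<in> D 0\<close> ab(2)]
      by (intro expanding[of u a b p q]) simp_all
  qed
  have D2_free: "b \<notin> N a" if "a \<in> D 2" "b \<in> D 2" for a b
    using N_sub[OF that(1)] not_D[OF that(2), of b 3] by auto
  have tetra: "dist u a = 2" "b \<in> D 2 \<Longrightarrow> a \<noteq> b \<Longrightarrow> dist a b = 2" if "a \<in> D 2" for a b
    using touch[of u a] touch[of a b] not_D[OF \<open>u \<in> D 0\<close> that] D2_free[OF that, of b]
      Nu uP P_D[OF that] P_D[of b 2] by simp_all
  have tetra4: "dist u a = 2" "dist u b = 2" "dist u c = 2" "dist a b = 2" "dist a c = 2" "dist b c = 2"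
    if "a \<in> D 2" "b \<in> D 2" "c \<in> D 2" "a \<noteq> b" "a \<noteq> c" "b \<noteq> c" for a b c
    by (intro tetra that)+
  have u3: "dist v u = 2" if "v \<in> D 3" for v
    using touch_sym[of v u] not_D[OF \<open>u \<in> D 0\<close> that] Nu uP P_D[OF that] by auto
  have t32: "dist v a = 2" if "v \<in> D 3" "a \<in> D 2" "v \<notin> N a" for v a
    using touch_sym[of v a] not_D[OF that(1,2)] that P_D by auto
  have t33: "dist p q = 2" "dist q p = 2" if "a \<in> D 2" "N a = {p, q}" "p \<noteq> q" for a p q
    using touch[of p q] touch_sym[of q p] pair[OF that] that(3) P_D by auto
  have strip: False
    if "a \<in> D 2" "b \<in> D 2" "c \<in> D 2" "distinct [a, b, c]" "distinct [p, q, r, s]"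
      "N a = {p, q}" "N b = {q, r}" "N c = {r, s}" for a b c p q r s
  proof -
    have D3: "p \<in> D 3" "q \<in> D 3" "r \<in> D 3" "s \<in> D 3"
      using pair[OF that(1,6)] pair[OF that(3,8)] that(5) by auto
    have ne: "s \<noteq> c" "p \<noteq> a" "r \<noteq> b" "q \<noteq> b"
      using not_D[OF D3(4) that(3)] not_D[OF D3(1) that(1)] not_D[OF D3(3) that(2)] not_D[OF D3(2) that(2)]
      by auto
    have pq_ne: "p \<noteq> q" "r \<noteq> s"
      using that(5) by auto
    have gap: "s \<notin> N a" "s \<notin> N b" "p \<notin> N b" "p \<notin> N c" "r \<notin> N a" "q \<notin> N c"
      unfolding that(6,7,8) using that(5) by auto
    have abc_ne: "a \<noteq> b" "a \<noteq> c" "b \<noteq> c"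
      using that(4) by auto
    have "dist q r \<noteq> 2"
      by (rule no_contact_closes_strip[OF tetra4[OF that(1,2,3) abc_ne]
        ne(1) u3[OF D3(4)] t32[OF D3(4) that(1) gap(1)] t32[OF D3(4) that(2) gap(2)]
        ne(2) u3[OF D3(1)] t32[OF D3(1) that(2) gap(3)] t32[OF D3(1) that(3) gap(4)]
        ne(3) u3[OF D3(3)] t32[OF D3(3) that(1) gap(5)] t33(1)[OF that(3,8) pq_ne(2)]
        ne(4) u3[OF D3(2)] t32[OF D3(2) that(3) gap(6)] t33(2)[OF that(1,6) pq_ne(1)]])
    then show False
      using t33(1)[OF that(2,7)] that(5) by simp
  qed
  have share: False
    if abc: "a \<in> D 2" "b \<in> D 2" "c \<in> D 2" "distinct [a, b, c]" and q: "q \<in> N a" "q \<in> N b" for a b c q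
  proof -
    obtain p where Na: "N a = {q, p}" "q \<noteq> p"
      using card_two_with[of "N a" q] abc(1) q by (auto simp: in_D)
    obtain r where Nb: "N b = {q, r}" "q \<noteq> r"
      using card_two_with[of "N b" q] abc(2) q by (auto simp: in_D)
    have "p \<noteq> r"
      using N_inj[OF abc(1,2)] abc(4) Na(1) Nb(1) by auto
    have pqr: "p \<in> D 3" "q \<in> D 3" "r \<in> D 3"
      using N_sub[OF abc(1)] N_sub[OF abc(2)] Na(1) Nb(1) by auto
    have "card (D 3 - {p, q, r}) = 1"
      using pqr Na(2) Nb(2) \<open>p \<noteq> r\<close> c by simp
    then obtain s where s: "D 3 - {p, q, r} = {s}"
      by (auto simp: card_1_singleton_iff)
    have s': "s \<in> D 3" "s \<notin> {p, q, r}" and D3: "D 3 \<subseteq> {p, q, r, s}"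
      using s by blast+
    have dist4: "distinct [p, q, r, s]"
      using Na(2) Nb(2) \<open>p \<noteq> r\<close> s'(2) by auto
    obtain v w where Nc: "N c = {v, w}" "v \<noteq> w"
      using abc(3) by (auto simp: in_D card_2_iff)
    have "{v, w} \<noteq> {q, p}" "{v, w} \<noteq> {q, r}"
      using N_inj[OF abc(1,3)] N_inj[OF abc(2,3)] abc(4) Na(1) Nb(1) Nc(1) by auto
    moreover have "v \<in> {p, q, r, s}" "w \<in> {p, q, r, s}"
      using N_sub[OF abc(3)] D3 Nc(1) by blast+
    ultimately have "N c = {p, r} \<or> N c = {q, s} \<or> N c = {r, s} \<or> N c = {p, s}"
      using Nc by (elim insertE emptyE) (simp_all add: insert_commute)
    then show False
    proof (elim disjE)
      assume Nc: "N c = {p, r}"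
      have "s \<notin> N a" "s \<notin> N b" "s \<notin> N c"
        using Na(1) Nb(1) Nc dist4 by auto
      moreover have "s \<noteq> u" "s \<notin> {a, b, c}" "u \<notin> {a, b, c}"
        using not_D[OF s'(1)] not_D[OF \<open>u \<in> D 0\<close>] abc(1,2,3) \<open>u \<in> D 0\<close> by auto
      ultimately show False
        using abc(4) P_D[OF abc(1)] P_D[OF abc(2)] P_D[OF abc(3)] P_D[OF s'(1)] uP Nu
          D2_free[OF abc(1,2)] D2_free[OF abc(1,3)] D2_free[OF abc(2,3)]
        by (intro no_K5[of u a b c s]) auto
    next
      assume Nc: "N c = {q, s}"
      have ne: "p \<noteq> a" "r \<noteq> b" "s \<noteq> c" and abc_ne: "a \<noteq> b" "a \<noteq> c" "b \<noteq> c"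
        using abc(4) not_D[OF pqr(1) abc(1)] not_D[OF pqr(3) abc(2)] not_D[OF s'(1) abc(3)] by simp_all
      have gap: "p \<notin> N b" "p \<notin> N c" "r \<notin> N a" "r \<notin> N c" "s \<notin> N a" "s \<notin> N b"
        unfolding Na(1) Nb(1) Nc using dist4 by auto
      have touch_q: "dist q p = 2" "dist q r = 2" "dist q s = 2"
        using t33(1)[OF abc(1) Na] t33(1)[OF abc(2) Nb] t33(1)[OF abc(3) Nc] dist4 by simp_all
      show False
        by (rule no_contact_closes_star[OF tetra4[OF abc(1,2,3) abc_ne]
          ne(1) u3[OF pqr(1)] t32[OF pqr(1) abc(2) gap(1)] t32[OF pqr(1) abc(3) gap(2)]
          ne(2) u3[OF pqr(3)] t32[OF pqr(3) abc(1) gap(3)] t32[OF pqr(3) abc(3) gap(4)]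
          ne(3) u3[OF s'(1)] t32[OF s'(1) abc(1) gap(5)] t32[OF s'(1) abc(2) gap(6)]
          u3[OF pqr(2)] touch_q])
    next
      assume Nc: "N c = {r, s}"
      show False
        using strip[OF abc dist4 _ Nb(1) Nc] Na(1) by (simp add: insert_commute)
    next
      assume Nc: "N c = {p, s}"
      show False
        by (rule strip[OF abc(2,1,3), of r q p s])
          (use abc(4) dist4 Na(1) Nb(1) Nc in \<open>simp_all add: insert_commute not_sym\<close>)
    qed
  qed
  obtain a b c' where abc: "D 2 = {a, b, c'}" "distinct [a, b, c']"
    using c(1) by (auto simp: card_3_iff)
  have mem: "a \<in> D 2" "b \<in> D 2" "c' \<in> D 2"
    unfolding abc(1) by simp_all
  have "N a \<inter> N b = {}" "N a \<inter> N c' = {}" "N b \<inter> N c' = {}"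
    using share[OF mem abc(2)] share[OF mem(1,3,2)] share[OF mem(2,3,1)] abc(2) by auto
  then have "card (N a \<union> N b \<union> N c') = 6"
    using mem by (simp add: card_Un_disjoint in_D Int_Un_distrib2)
  moreover have "card (N a \<union> N b \<union> N c') \<le> card (D 3)"
    using N_sub[OF mem(1)] N_sub[OF mem(2)] N_sub[OF mem(3)] by (intro card_mono) simp_all
  ultimately show False
    using c(2) by simp
qed

text \<open>Counting degrees, \<open>k\<close> leaves and no isolated points leave \<open>k + 2\<close> points of degree three and
\<open>6 - 2 * k\<close> of degree two, so that \<open>k\<close> is at most three.\<close>

lemma impossible: False
proof -
  consider "card (D 0) = 1" | "card (D 0) = 0"
    using at_most_one_isolated by linarith
  then show False
  proof cases
    case 1
    then show False
      by (rule isolated_False)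
  next
    case 2
    then have D0: "D 0 = {}"
      by simp
    have "card (D 1) = 0 \<or> card (D 1) = 1 \<or> card (D 1) = 2 \<or> card (D 1) = 3"
      using counts 2 by linarith
    then show False
      using no_leaf_False[OF D0] one_leaf_False[OF D0] two_leaves_False[OF D0] three_leaves_False[OF D0]
      by auto
  qed
qed

end

text \<open>A gap sum of 18 is excluded above. A smaller even sum is at most 16, and deleting a point then shows
that all degrees are at most two; this leaves too few outside neighbors for a point of degree two
and its neighbors, and degrees at most one would contradict \<open>gap_sum_seven\<close> directly.\<close>

lemma (in packing) gap_sum_eight:
  assumes P8: "card P = 8" and ev: "even (\<Sum>p\<in>P. card (N p))"
  shows "18 < (\<Sum>p\<in>P. card (N p))"
proof (rule ccontr)
  assume "\<not> 18 < (\<Sum>p\<in>P. card (N p))"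
  then have le18: "(\<Sum>p\<in>P. card (N p)) \<le> 18"
    by simp
  have deletion: "10 + 2 * card (N v) < (\<Sum>p\<in>P. card (N p))" if "v \<in> P" for v
  proof -
    interpret Q: packing "P - {v}"
      by (rule packing_remove)
    have "10 < (\<Sum>p\<in>P - {v}. card (gaps (P - {v}) p))"
      using that P8 finite_P by (intro Q.gap_sum_seven) simp
    then show ?thesis
      using sum_gaps_remove[OF that] by linarith
  qed
  have le3: "card (N v) \<le> 3" if "v \<in> P" for v
    using deletion[OF that] le18 by simp
  have "(\<Sum>p\<in>P. card (N p)) \<noteq> 18"
  proof
    assume "(\<Sum>p\<in>P. card (N p)) = 18"
    then have "dense_eight P"
      using P8 le3 by unfold_locales
    then show False
      by (rule dense_eight.impossible)
  qed
  then have le16: "(\<Sum>p\<in>P. card (N p)) \<le> 16"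
    using le18 ev by presburger
  have le2: "card (N v) \<le> 2" if "v \<in> P" for v
    using deletion[OF that] le16 by simp
  have "card (N y) \<le> 1" if y: "y \<in> P" for y
  proof (rule ccontr)
    assume "\<not> card (N y) \<le> 1"
    then have "card (N y) = 2"
      using le2[OF y] by simp
    then obtain x w where Ny: "N y = {x, w}" "x \<noteq> w"
      by (auto simp: card_2_iff)
    have one: "v \<in> P \<and> v \<noteq> y \<and> (\<exists>b. N v - {y} \<subseteq> {b})" if "v \<in> N y" for v
    proof -
      have v: "v \<in> P" "v \<noteq> y" "y \<in> N v"
        using that gaps_subset[of y] not_self[of y] gaps_sym[of y v] y by auto
      then have "card (N v - {y}) \<le> 1"
        using le2[of v] by simp
      then obtain b where "N v - {y} \<subseteq> {b}"
        by (rule subset_one_if_card_le[OF finite_Diff[OF finite_gaps]])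
      then show ?thesis
        using v by blast
    qed
    obtain b where x: "x \<in> P" "x \<noteq> y" "N x - {y} \<subseteq> {b}"
      using one[of x] Ny(1) by auto
    obtain c where w: "w \<in> P" "w \<noteq> y" "N w - {y} \<subseteq> {c}"
      using one[of w] Ny(1) by auto
    have "N y \<union> N x \<union> N w \<subseteq> {y, x, w} \<union> {b, c}"
      using Ny(1) x(3) w(3) by blast
    then have "card P \<le> card {b, c} + 5"
      using y x w Ny(2) by (intro three_points_bound) auto
    moreover have "card {b, c} \<le> 2"
      by (simp add: card_insert_if)
    ultimately show False
      using P8 by simp
  qed
  then have "(\<Sum>p\<in>P. card (N p)) \<le> 8"
    using sum_mono[of P "\<lambda>p. card (N p)" "\<lambda>p. 1"] P8 by simp
  moreover have "P \<noteq> {}"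
    using P8 by auto
  ultimately show False
    using deletion by fastforce
qed


section \<open>From packings to gap graphs\<close>

lemma handshake:
  assumes "finite I" and sym: "\<And>i j. R i j \<Longrightarrow> R j i" and irrefl: "\<And>i. \<not> R i i"
  shows "(\<Sum>i\<in>I. card {j \<in> I. R i j}) = 2 * card {{i, j} | i j. i \<in> I \<and> j \<in> I \<and> R i j}"
    (is "_ = 2 * card ?E")
proof -
  have fin: "finite ?E"
    by (rule finite_subset[of _ "Pow I"]) (use \<open>finite I\<close> in auto)
  have "card {j \<in> I. R i j} = (\<Sum>e\<in>?E. if i \<in> e then 1 else 0)" if "i \<in> I" for i
  proof -
    have "{e \<in> ?E. i \<in> e} = (\<lambda>j. {i, j}) ` {j \<in> I. R i j}"
      using that sym by (auto simp: insert_commute)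
    moreover have "inj_on (\<lambda>j. {i, j}) {j \<in> I. R i j}"
      by (auto simp: inj_on_def doubleton_eq_iff)
    ultimately have "card {j \<in> I. R i j} = card {e \<in> ?E. i \<in> e}"
      by (simp add: card_image)
    then show ?thesis
      using fin by (simp flip: sum.inter_filter)
  qed
  then have "(\<Sum>i\<in>I. card {j \<in> I. R i j}) = (\<Sum>i\<in>I. \<Sum>e\<in>?E. if i \<in> e then 1 else 0)"
    by simp
  also have "\<dots> = (\<Sum>e\<in>?E. \<Sum>i\<in>I. if i \<in> e then 1 else 0)"
    by (rule sum.swap)
  also have "\<dots> = (\<Sum>e\<in>?E. 2)"
  proof (rule sum.cong)
    fix e assume "e \<in> ?E"
    then obtain i j where e: "e = {i, j}" "i \<in> I" "j \<in> I" "R i j"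
      by auto
    then have "{k \<in> I. k \<in> e} = {i, j}" "i \<noteq> j"
      using irrefl by auto
    then show "(\<Sum>i\<in>I. if i \<in> e then 1 else 0) = (2 :: nat)"
      using \<open>finite I\<close> by (simp flip: sum.inter_filter)
  qed simp
  finally show ?thesis
    by simp
qed


lemma touching_pairs_le:
  assumes packed: "unit_sphere_packing 8 x"
  shows "card (touching_pairs 8 x) \<le> 18"
proof -
  define I where "I = {1..8::nat}"
  have sep: "2 \<le> dist (x i) (x j)" if "i \<in> I" "j \<in> I" "i \<noteq> j" for i j
    using packed that by (auto simp: unit_sphere_packing_iff I_def dist_norm)
  then have inj: "inj_on x I"
    by (force simp: inj_on_def)
  define R where "R i j \<longleftrightarrow> i \<noteq> j \<and> norm (x i - x j) = 2" for i j
  have I: "finite I" "card I = 8"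
    by (simp_all add: I_def)
  have "touching_pairs 8 x = {{i, j} | i j. i \<in> I \<and> j \<in> I \<and> R i j}"
    by (simp add: touching_pairs_def I_def R_def)
  then have shake: "(\<Sum>i\<in>I. card {j \<in> I. R i j}) = 2 * card (touching_pairs 8 x)"
    using handshake[of I R] I by (simp add: R_def norm_minus_commute)
  interpret packing "x ` I"
    by unfold_locales (use I sep in auto)
  have "card (N (x i)) + card {j \<in> I. R i j} = 7" if i: "i \<in> I" for i
  proof -
    have "N (x i) = x ` (I - {i} - {j \<in> I. R i j})"
      using i inj by (auto simp: gaps_def R_def dist_norm inj_on_def)
    then have "card (N (x i)) = card (I - {i} - {j \<in> I. R i j})"
      using inj by (simp add: card_image inj_on_subset Diff_subset subset_trans[OF Diff_subset])
    also have "\<dots> = card (I - {i}) - card {j \<in> I. R i j}"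
      using I by (intro card_Diff_subset) (auto simp: R_def)
    finally have "card (N (x i)) = 7 - card {j \<in> I. R i j}"
      using I i by simp
    moreover have "card {j \<in> I. R i j} \<le> card (I - {i})"
      using I by (intro card_mono) (auto simp: R_def)
    ultimately show ?thesis
      using I i by simp
  qed
  then have "(\<Sum>i\<in>I. card (N (x i)) + card {j \<in> I. R i j}) = (\<Sum>i\<in>I. 7)"
    by (intro sum.cong) simp_all
  then have sum: "(\<Sum>p\<in>x ` I. card (N p)) + 2 * card (touching_pairs 8 x) = 56"
    using I inj shake by (simp add: sum.distrib sum.reindex)
  then have "even ((\<Sum>p\<in>x ` I. card (N p)) + 2 * card (touching_pairs 8 x))"
    by simp
  then have "even (\<Sum>p\<in>x ` I. card (N p))"
    by simp
  then have "18 < (\<Sum>p\<in>x ` I. card (N p))"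
    using I inj by (intro gap_sum_eight) (simp_all add: card_image)
  then show ?thesis
    using sum by linarith
qed


section \<open>A packing with eighteen contacts\<close>

text \<open>The corners of an octahedron and the caps of two opposite faces, as points of the lattice
\<open>\<int>\<^sup>3\<close> scaled by \<open>sqrt 2\<close>. All distances are then integer computations, in which a contact is a
squared distance 2.\<close>

definition capped_octahedron_coord :: "nat \<Rightarrow> nat \<Rightarrow> int" where
  "capped_octahedron_coord k i =
    [[1, 0, 0, - 1, 0, 0, 1, - 1], [0, 1, 0, 0, - 1, 0, 1, - 1], [0, 0, 1, 0, 0, - 1, 1, - 1]] ! k ! (i - 1)"

definition capped_octahedron :: "nat \<Rightarrow> real ^ 3" where
  "capped_octahedron i = sqrt 2 *\<^sub>R vector [real_of_int (capped_octahedron_coord 0 i),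
    real_of_int (capped_octahedron_coord 1 i), real_of_int (capped_octahedron_coord 2 i)]"

definition coord_dist2 :: "nat \<Rightarrow> nat \<Rightarrow> int" where
  "coord_dist2 i j = (\<Sum>k<3. (capped_octahedron_coord k i - capped_octahedron_coord k j)\<^sup>2)"

lemma dist_capped_octahedron:
  "(norm (capped_octahedron i - capped_octahedron j))\<^sup>2 = 2 * real_of_int (coord_dist2 i j)"
proof -
  have "(norm (sqrt 2 *\<^sub>R v))\<^sup>2 = 2 * ((v $ 1)\<^sup>2 + (v $ 2)\<^sup>2 + (v $ 3)\<^sup>2)" for v :: "real ^ 3"
  proof -
    have "(norm v)\<^sup>2 = (v $ 1)\<^sup>2 + (v $ 2)\<^sup>2 + (v $ 3)\<^sup>2"
      unfolding power2_norm_eq_inner by (simp add: inner_vec_def sum_3 power2_eq_square)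
    then show ?thesis
      by (simp add: power_mult_distrib)
  qed
  then show ?thesis
    unfolding capped_octahedron_def coord_dist2_def scaleR_diff_right[symmetric]
    by (simp add: eval_nat_numeral lessThan_Suc)
qed

lemma capped_octahedron_packing: "unit_sphere_packing 8 capped_octahedron"
proof -
  have "\<forall>i\<in>{1..8}. \<forall>j\<in>{1..8}. i \<noteq> j \<longrightarrow> 2 \<le> coord_dist2 i j"
    by code_simp
  then have "2 \<le> coord_dist2 i j" if "i \<in> {1..8}" "j \<in> {1..8}" "i \<noteq> j" for i j
    using that by blast
  then have "2\<^sup>2 \<le> (norm (capped_octahedron i - capped_octahedron j))\<^sup>2"
    if "i \<in> {1..8}" "j \<in> {1..8}" "i \<noteq> j" for i j
    using that unfolding dist_capped_octahedron by fastforce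
  then show ?thesis
    unfolding unit_sphere_packing_iff by (meson norm_ge_zero power2_le_imp_le)
qed

lemma card_touching_pairs_capped_octahedron: "card (touching_pairs 8 capped_octahedron) = 18"
proof -
  have touch_iff: "norm (capped_octahedron i - capped_octahedron j) = 2 \<longleftrightarrow> coord_dist2 i j = 2" for i j
  proof -
    have "norm (capped_octahedron i - capped_octahedron j) = 2 \<longleftrightarrow>
        (norm (capped_octahedron i - capped_octahedron j))\<^sup>2 = 2\<^sup>2"
      by (metis power2_eq_iff_nonneg norm_ge_zero zero_le_numeral)
    then show ?thesis
      unfolding dist_capped_octahedron by simp
  qed
  have "36 = (\<Sum>i\<in>{1..8}. card {j \<in> {1..8}. coord_dist2 i j = 2})"
    by code_simp
  also have "\<dots> = 2 * card {{i, j} | i j. i \<in> {1..8} \<and> j \<in> {1..8} \<and> coord_dist2 i j = 2}"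
    by (rule handshake) (auto simp: coord_dist2_def power2_commute)
  also have "{{i, j} | i j. i \<in> {1..8} \<and> j \<in> {1..8} \<and> coord_dist2 i j = 2}
      = touching_pairs 8 capped_octahedron"
    unfolding touching_pairs_def touch_iff by (metis (no_types, lifting) touch_iff norm_zero diff_self zero_neq_numeral)
  finally show ?thesis
    by simp
qed


theorem theorem4:
  shows "contact_number 8 = 18"
  unfolding contact_number_def
proof (rule Max_eqI)
  show "finite {card (touching_pairs 8 x) | x. unit_sphere_packing 8 x}"
    by (rule contact_counts_finite)
  show "k \<le> 18" if "k \<in> {card (touching_pairs 8 x) | x. unit_sphere_packing 8 x}" for k
    using that touching_pairs_le by auto
  show "18 \<in> {card (touching_pairs 8 x) | x. unit_sphere_packing 8 x}"
    using capped_octahedron_packing card_touching_pairs_capped_octahedron by (metis (mono_tags, lifting) mem_Collect_eq)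
qed

end
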